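(* Let $A=B_1B_2\cdots B_k\in\mathbb{R}^{n\times n}$, where the $B_i\in\mathbb{R}^{n\times n}$ are nonsingular bidiagonal matrices (each upper or lower bidiagonal), let $b\in\mathbb{R}^n$, and let $x$ be the exact solution of $Ax=b$. Suppose the system is solved in floating-point arithmetic with unit roundoff $u$ by successively solving the $k$ bidiagonal systems with coefficient matrices $B_1,B_2,\dots,B_k$ by substitution, and let $\widehat{x}$ be the computed solution. Put $\gamma_2=2u/(1-2u)$ and $\tau=(2n-1)\gamma_2/(1-(2n-1)\gamma_2)$, where $2u<1$ and $(2n-1)\gamma_2<1$. Then $$|b-A\widehat{x}|\le\bigl((1+\gamma_2)^k-1\bigr)|B_1|\,|B_2|\cdots|B_k|\,|\widehat{x}|,$$ $$|\widehat{x}-x|\le\bigl((1+\tau)^k-1\bigr)|B_k^{-1}|\,|B_{k-1}^{-1}|\cdots|B_1^{-1}|\,|b|.$$ If, moreover, all the $B_i$ are nonnegative or all the $B_i$ have a checkerboard sign pattern, then $$|b-A\widehat{x}|\le\bigl((1+\gamma_2)^k-1\bigr)|A|\,|\widehat{x}|=\bigl(2ku+O(u^2)\bigr)|A|\,|\widehat{x}|,$$ $$|\widehat{x}-x|\le\bigl((1+\tau)^k-1\bigr)|A^{-1}|\,|b|=\bigl(2k(2n-1)u+O(u^2)\bigr)|A^{-1}|\,|b|.$$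
   Context: For a matrix or vector, $|\cdot|$ is taken entrywise, and inequalities between matrices or vectors hold componentwise. The standard model of floating-point arithmetic is used: every operation $\mathrm{op}\in\{+,-,\times,/\}$ on floating-point numbers satisfies $\mathrm{fl}(x\,\mathrm{op}\,y)=(x\,\mathrm{op}\,y)(1+\delta)$ with $|\delta|\le u$. The $O(u^2)$ terms are as $u\to0$ with $n,k$ fixed. A matrix $C\in\mathbb{R}^{n\times n}$ has a checkerboard sign pattern if $C=\Sigma|C|\Sigma$ or $C=-\Sigma|C|\Sigma$, where $\Sigma=\operatorname{diag}(1,-1,1,\dots,(-1)^{n-1})$. A matrix is nonnegative if all its entries are nonnegative. A matrix is upper bidiagonal if its only possibly nonzero entries are in positions $(i,i)$ and $(i,i+1)$; it is lower bidiagonal if its transpose is upper bidiagonal. *)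

theory Defs
  imports
    "Jordan_Normal_Form.Gauss_Jordan_Elimination"
    "HOL-Library.Landau_Symbols"
begin

abbreviation abs_mat :: "real mat \<Rightarrow> real mat" where
  "abs_mat \<equiv> map_mat abs"

abbreviation abs_vec :: "real vec \<Rightarrow> real vec" where
  "abs_vec \<equiv> map_vec abs"

text \<open>Only meaningful for invertible arguments; otherwise the value is unspecified.\<close>
definition inv_mat :: "real mat \<Rightarrow> real mat" where
  "inv_mat A = the (mat_inverse A)"

definition mat_prod :: "nat \<Rightarrow> real mat list \<Rightarrow> real mat" where
  "mat_prod n As = foldr (*) As (1\<^sub>m n)"

definition upper_bidiagonal :: "real mat \<Rightarrow> bool" where
  "upper_bidiagonal B \<longleftrightarrow>
     (\<forall>i < dim_row B. \<forall>j < dim_col B. j \<noteq> i \<and> j \<noteq> Suc i \<longrightarrow> B $$ (i,j) = 0)"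

definition lower_bidiagonal :: "real mat \<Rightarrow> bool" where
  "lower_bidiagonal B \<longleftrightarrow> upper_bidiagonal (transpose_mat B)"

definition nonneg_mat :: "real mat \<Rightarrow> bool" where
  "nonneg_mat C \<longleftrightarrow> (\<forall>c \<in> elements_mat C. 0 \<le> c)"

definition sign_mat :: "nat \<Rightarrow> real mat" where
  "sign_mat n = mat n n (\<lambda>(i,j). if i = j then (-1) ^ i else 0)"

definition checkerboard :: "real mat \<Rightarrow> bool" where
  "checkerboard C \<longleftrightarrow>
     (let S = sign_mat (dim_row C) in
        C = S * abs_mat C * S \<or> C = - (S * abs_mat C * S))"

datatype flop = Add | Sub | Mul | Div

fun exact :: "flop \<Rightarrow> real \<Rightarrow> real \<Rightarrow> real" where
  "exact Add x y = x + y"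
| "exact Sub x y = x - y"
| "exact Mul x y = x * y"
| "exact Div x y = x / y"

text \<open>The set \<open>F\<close> consists of the floating-point numbers and \<open>fl op x y\<close> is the
  computed value of \<open>x op y\<close>. As the model has neither overflow nor underflow, \<open>F\<close> is
  closed under the computed operations.\<close>
definition standard_model ::
    "real \<Rightarrow> real set \<Rightarrow> (flop \<Rightarrow> real \<Rightarrow> real \<Rightarrow> real) \<Rightarrow> bool" where
  "standard_model u F fl \<longleftrightarrow>
     0 \<le> u \<and>
     (\<forall>op. \<forall>x \<in> F. \<forall>y \<in> F. (op = Div \<longrightarrow> y \<noteq> 0) \<longrightarrow>
        fl op x y \<in> F \<and> (\<exists>\<delta>. \<bar>\<delta>\<bar> \<le> u \<and> fl op x y = exact op x y * (1 + \<delta>)))"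

fun forward_entry ::
    "(flop \<Rightarrow> real \<Rightarrow> real \<Rightarrow> real) \<Rightarrow> real mat \<Rightarrow> real vec \<Rightarrow> nat \<Rightarrow> real" where
  "forward_entry fl B c 0 = fl Div (c $ 0) (B $$ (0,0))"
| "forward_entry fl B c (Suc i) =
     fl Div (fl Sub (c $ Suc i) (fl Mul (B $$ (Suc i, i)) (forward_entry fl B c i)))
            (B $$ (Suc i, Suc i))"

definition forward_subst ::
    "(flop \<Rightarrow> real \<Rightarrow> real \<Rightarrow> real) \<Rightarrow> real mat \<Rightarrow> real vec \<Rightarrow> real vec" where
  "forward_subst fl B c = vec (dim_vec c) (forward_entry fl B c)"

function back_entry ::
    "(flop \<Rightarrow> real \<Rightarrow> real \<Rightarrow> real) \<Rightarrow> real mat \<Rightarrow> real vec \<Rightarrow> nat \<Rightarrow> real" where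
  "back_entry fl B c i =
     (if Suc i < dim_vec c
      then fl Div (fl Sub (c $ i) (fl Mul (B $$ (i, Suc i)) (back_entry fl B c (Suc i))))
                  (B $$ (i,i))
      else fl Div (c $ i) (B $$ (i,i)))"
  by pat_completeness auto
termination
  by (relation "measure (\<lambda>(fl, B, c, i). dim_vec c - i)") auto

declare back_entry.simps [simp del]

definition back_subst ::
    "(flop \<Rightarrow> real \<Rightarrow> real \<Rightarrow> real) \<Rightarrow> real mat \<Rightarrow> real vec \<Rightarrow> real vec" where
  "back_subst fl B c = vec (dim_vec c) (back_entry fl B c)"

text \<open>A relation rather than a function: a diagonal matrix is both upper and lower
  bidiagonal, and then either substitution may be used.\<close>
definition bidiagonal_solve ::
    "(flop \<Rightarrow> real \<Rightarrow> real \<Rightarrow> real) \<Rightarrow> real mat \<Rightarrow> real vec \<Rightarrow> real vec \<Rightarrow> bool" where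
  "bidiagonal_solve fl B c y \<longleftrightarrow>
     upper_bidiagonal B \<and> y = back_subst fl B c \<or>
     lower_bidiagonal B \<and> y = forward_subst fl B c"

fun successive_solve ::
    "(flop \<Rightarrow> real \<Rightarrow> real \<Rightarrow> real) \<Rightarrow> real mat list \<Rightarrow> real vec \<Rightarrow> real vec \<Rightarrow> bool" where
  "successive_solve fl [] b z \<longleftrightarrow> z = b"
| "successive_solve fl (B # Bs) b z \<longleftrightarrow>
     (\<exists>y. bidiagonal_solve fl B b y \<and> successive_solve fl Bs y z)"

definition gamma2 :: "real \<Rightarrow> real" where
  "gamma2 u = 2 * u / (1 - 2 * u)"

definition tau :: "nat \<Rightarrow> real \<Rightarrow> real" where
  "tau n u = (2 * real n - 1) * gamma2 u / (1 - (2 * real n - 1) * gamma2 u)"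

end

theory Submission
  imports Defs
begin

text \<open>Both bounds are one accumulation principle applied to two chains of vectors. If
\<open>\<bar>v\<^sub>i - M\<^sub>i v\<^sub>i\<^sub>+\<^sub>1\<bar> \<le> \<epsilon> \<bar>M\<^sub>i\<bar> \<bar>v\<^sub>i\<^sub>+\<^sub>1\<bar>\<close> at every link, then replacing the links one after the other multiplies the
relative error by \<open>1 + \<epsilon>\<close> each time, so that
\<open>\<bar>v\<^sub>1 - M\<^sub>1 \<dots> M\<^sub>k v\<^sub>k\<^sub>+\<^sub>1\<bar> \<le> ((1 + \<epsilon>)^k - 1) \<bar>M\<^sub>1\<bar> \<dots> \<bar>M\<^sub>k\<bar> \<bar>v\<^sub>k\<^sub>+\<^sub>1\<bar>\<close> (\<open>perturbed_chain_bound\<close>). The residual bound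
reads the computation from \<open>b\<close> to the computed solution, with the factors \<open>B\<^sub>i\<close> and \<open>\<epsilon> = gamma2 u\<close>;
the forward bound reads it backwards, from the computed solution to \<open>b\<close>, with the inverses
\<open>B\<^sub>k\<^sup>-\<^sup>1, \<dots>, B\<^sub>1\<^sup>-\<^sup>1\<close> and \<open>\<epsilon> = tau n u\<close>.

What remains is one bidiagonal system \<open>B y = c\<close> (\<open>bidiagonal_solve_error\<close>). Forward and back
substitution are the same two-term recursion \<open>d\<^sub>i z\<^sub>i = c\<^sub>i - l\<^sub>i\<^sub>-\<^sub>1 z\<^sub>i\<^sub>-\<^sub>1\<close>, run through the unknowns in
increasing or decreasing order, with three rounding errors per step. Moving two of them to the
left-hand side gives the residual bound. For the forward bound, the vector \<open>w = \<bar>B\<^sup>-\<^sup>1\<bar> \<bar>c\<bar>\<close> satisfies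
the recursion without cancellation, \<open>\<bar>d\<^sub>i\<bar> w\<^sub>i = \<bar>c\<^sub>i\<bar> + \<bar>l\<^sub>i\<^sub>-\<^sub>1\<bar> w\<^sub>i\<^sub>-\<^sub>1\<close>, because
an off-diagonal entry of a bidiagonal inverse is a single product of quotients \<open>- l / d\<close> and a
reciprocal \<open>1 / d\<close>. Hence each step adds at most a factor
\<open>(1 + u)\<^sup>3\<close> to the error relative to \<open>w\<close>, and \<open>(1 + u)^(3 n - 1) \<le> 1 + tau n u\<close>.

Finally, matrices of the form \<open>\<plusminus> D \<bar>C\<bar> D\<close> with a common diagonal sign matrix \<open>D\<close> multiply without
cancellation. Nonnegative and checkerboard factors are of this form, with \<open>D = I\<close> and
\<open>D = \<Sigma>\<close> respectively, and the inverses of bidiagonal ones are again of this form, with \<open>D\<close>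
replaced by \<open>D \<Sigma>\<close>. So \<open>\<bar>A\<bar>\<close> and \<open>\<bar>A\<^sup>-\<^sup>1\<bar>\<close> are the products of the absolute values of the factors.\<close>

section \<open>Products of matrices and absolute values\<close>

lemma mat_prod_Nil [simp]: "mat_prod n [] = 1\<^sub>m n"
  by (simp add: mat_prod_def)

lemma mat_prod_Cons [simp]: "mat_prod n (M # Ms) = M * mat_prod n Ms"
  by (simp add: mat_prod_def)

lemma mat_prod_carrier:
  "(\<And>M. M \<in> set Ms \<Longrightarrow> M \<in> carrier_mat n n) \<Longrightarrow> mat_prod n Ms \<in> carrier_mat n n"
  by (induction Ms) (auto intro!: mult_carrier_mat)

lemma mat_prod_append:
  assumes "\<And>M. M \<in> set Ms \<Longrightarrow> M \<in> carrier_mat n n" and N: "N \<in> carrier_mat n n"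
  shows "mat_prod n (Ms @ [N]) = mat_prod n Ms * N"
  using assms(1)
proof (induction Ms)
  case Nil
  then show ?case using N by simp
next
  case (Cons M Ms)
  then show ?case
    using N mat_prod_carrier[of Ms n] by (simp add: assoc_mult_mat[of M n n _ n N n])
qed

lemma mult_mat_vec_entry:
  assumes "M \<in> carrier_mat m n" "v \<in> carrier_vec n" "i < m"
  shows "(M *\<^sub>v v) $ i = (\<Sum>j<n. M $$ (i,j) * v $ j)"
  using assms by (auto simp: scalar_prod_def atLeast0LessThan)

lemma mult_mat_entry:
  assumes "M \<in> carrier_mat m n" "N \<in> carrier_mat n p" "i < m" "j < p"
  shows "(M * N) $$ (i,j) = (\<Sum>k<n. M $$ (i,k) * N $$ (k,j))"
  using assms by (auto simp: scalar_prod_def atLeast0LessThan)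

lemma abs_mult_mat_vec_entry_le:
  fixes M :: "real mat"
  assumes "M \<in> carrier_mat m n" "v \<in> carrier_vec n" "i < m"
  shows "\<bar>(M *\<^sub>v v) $ i\<bar> \<le> (\<Sum>j<n. \<bar>M $$ (i,j)\<bar> * \<bar>v $ j\<bar>)"
  unfolding mult_mat_vec_entry[OF assms] by (rule order.trans[OF sum_abs]) (simp add: abs_mult)

lemma abs_mat_mult_vec_entry:
  assumes "M \<in> carrier_mat m n" "v \<in> carrier_vec n" "i < m"
  shows "(abs_mat M *\<^sub>v v) $ i = (\<Sum>j<n. \<bar>M $$ (i,j)\<bar> * v $ j)"
  using mult_mat_vec_entry[of "abs_mat M" m n v i] assms by simp

lemma abs_mat_prod_mult_vec_le:
  fixes z :: "real vec"
  assumes "\<And>M. M \<in> set Ms \<Longrightarrow> M \<in> carrier_mat n n" and z: "z \<in> carrier_vec n" and "i < n"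
  shows "\<bar>(mat_prod n Ms *\<^sub>v z) $ i\<bar> \<le> (mat_prod n (map abs_mat Ms) *\<^sub>v abs_vec z) $ i"
  using assms(1,3)
proof (induction Ms arbitrary: i)
  case Nil
  then show ?case using z by simp
next
  case (Cons M Ms)
  let ?P = "mat_prod n Ms" and ?Q = "mat_prod n (map abs_mat Ms)"
  have M: "M \<in> carrier_mat n n" and P: "?P \<in> carrier_mat n n" and Q: "?Q \<in> carrier_mat n n"
    using Cons.prems by (auto intro!: mat_prod_carrier)
  have "\<bar>(M *\<^sub>v (?P *\<^sub>v z)) $ i\<bar> \<le> (\<Sum>j<n. \<bar>M $$ (i,j)\<bar> * \<bar>(?P *\<^sub>v z) $ j\<bar>)"
    by (rule abs_mult_mat_vec_entry_le[OF M _ Cons.prems(2)]) (use P z in auto)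
  also have "\<dots> \<le> (\<Sum>j<n. \<bar>M $$ (i,j)\<bar> * (?Q *\<^sub>v abs_vec z) $ j)"
    using Cons.IH Cons.prems by (intro sum_mono mult_left_mono) auto
  also have "\<dots> = (abs_mat M *\<^sub>v (?Q *\<^sub>v abs_vec z)) $ i"
    by (rule abs_mat_mult_vec_entry[symmetric, OF M _ Cons.prems(2)]) (use Q z in auto)
  finally show ?case
    using M P Q z by (simp add: assoc_mult_mat_vec[of _ n n _ n])
qed

section \<open>Accumulation of componentwise relative errors\<close>

text \<open>The intermediate vectors are existentially quantified. For \<open>v = b\<close> they are the computed solutions of
the successive systems; for the inverse factors they are the same vectors in the opposite order.\<close>

fun perturbed_chain :: "nat \<Rightarrow> real \<Rightarrow> real mat list \<Rightarrow> real vec \<Rightarrow> real vec \<Rightarrow> bool" where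
  "perturbed_chain n \<epsilon> [] v z \<longleftrightarrow> v = z"
| "perturbed_chain n \<epsilon> (M # Ms) v z \<longleftrightarrow>
     (\<exists>y \<in> carrier_vec n. abs_vec (v - M *\<^sub>v y) \<le> \<epsilon> \<cdot>\<^sub>v (abs_mat M *\<^sub>v abs_vec y)
        \<and> perturbed_chain n \<epsilon> Ms y z)"

lemma perturbed_chain_snoc:
  assumes "perturbed_chain n \<epsilon> Ms v y" and "y \<in> carrier_vec n" and "z \<in> carrier_vec n"
    and "abs_vec (y - M *\<^sub>v z) \<le> \<epsilon> \<cdot>\<^sub>v (abs_mat M *\<^sub>v abs_vec z)"
  shows "perturbed_chain n \<epsilon> (Ms @ [M]) v z"
  using assms by (induction Ms arbitrary: v) auto

text \<open>Write \<open>E = (1 + \<epsilon>)^m\<close> for the tail of length \<open>m\<close>, \<open>P\<close> for its product and \<open>q\<close> for the product of the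
absolute values applied to \<open>\<bar>z\<bar>\<close>. By induction \<open>\<bar>y - P z\<bar> \<le> (E - 1) q\<close>, hence \<open>\<bar>y\<bar> \<le> E q\<close>. The new
link contributes \<open>\<epsilon> \<bar>M\<bar> \<bar>y\<bar> \<le> \<epsilon> E \<bar>M\<bar> q\<close> and the inherited error at most \<open>(E - 1) \<bar>M\<bar> q\<close>; the sum of the
factors is \<open>(1 + \<epsilon>) E - 1\<close>.\<close>

lemma perturbed_chain_bound:
  fixes v z :: "real vec"
  assumes "perturbed_chain n \<epsilon> Ms v z" and "0 \<le> \<epsilon>"
    and "\<And>M. M \<in> set Ms \<Longrightarrow> M \<in> carrier_mat n n"
    and "v \<in> carrier_vec n" and z: "z \<in> carrier_vec n"
  shows "abs_vec (v - mat_prod n Ms *\<^sub>v z)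
    \<le> ((1 + \<epsilon>) ^ length Ms - 1) \<cdot>\<^sub>v (mat_prod n (map abs_mat Ms) *\<^sub>v abs_vec z)"
  using assms(1,3,4)
proof (induction Ms arbitrary: v)
  case Nil
  then show ?case using z by (auto simp: less_eq_vec_def)
next
  case (Cons M Ms)
  let ?P = "mat_prod n Ms" and ?Q = "mat_prod n (map abs_mat Ms)"
  let ?E = "(1 + \<epsilon>) ^ length Ms" and ?q = "?Q *\<^sub>v abs_vec z"
  have M: "M \<in> carrier_mat n n" and P: "?P \<in> carrier_mat n n" and Q: "?Q \<in> carrier_mat n n"
    using Cons.prems by (auto intro!: mat_prod_carrier)
  obtain y where y: "y \<in> carrier_vec n"
    and step: "abs_vec (v - M *\<^sub>v y) \<le> \<epsilon> \<cdot>\<^sub>v (abs_mat M *\<^sub>v abs_vec y)"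
    and chain: "perturbed_chain n \<epsilon> Ms y z"
    using Cons.prems(1) by auto
  have IH: "\<bar>y $ j - (?P *\<^sub>v z) $ j\<bar> \<le> (?E - 1) * ?q $ j" if "j < n" for j
    using Cons.IH[OF chain _ y] Cons.prems(2) that P Q z by (auto simp: less_eq_vec_def)
  have y_le: "\<bar>y $ j\<bar> \<le> ?E * ?q $ j" if "j < n" for j
    using IH[OF that] abs_mat_prod_mult_vec_le[OF _ z that, of Ms] Cons.prems(2)
    by (simp add: algebra_simps)
  have Pz: "?P *\<^sub>v z \<in> carrier_vec n" using P z by simp
  have q: "?q \<in> carrier_vec n" using Q z by simp
  have "\<bar>v $ i - (M *\<^sub>v (?P *\<^sub>v z)) $ i\<bar> \<le> ((1 + \<epsilon>) * ?E - 1) * (abs_mat M *\<^sub>v ?q) $ i"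
    if i: "i < n" for i
  proof -
    have "\<bar>v $ i - (M *\<^sub>v y) $ i\<bar> \<le> \<epsilon> * (abs_mat M *\<^sub>v abs_vec y) $ i"
      using step i M y Cons.prems(3) by (auto simp: less_eq_vec_def)
    also have "\<dots> = \<epsilon> * (\<Sum>j<n. \<bar>M $$ (i,j)\<bar> * \<bar>y $ j\<bar>)"
      using y by (subst abs_mat_mult_vec_entry[OF M _ i]) auto
    also have "\<dots> \<le> \<epsilon> * (\<Sum>j<n. \<bar>M $$ (i,j)\<bar> * (?E * ?q $ j))"
      using y_le \<open>0 \<le> \<epsilon>\<close> by (intro mult_left_mono sum_mono) auto
    also have "\<dots> = \<epsilon> * ?E * (\<Sum>j<n. \<bar>M $$ (i,j)\<bar> * ?q $ j)"
      by (simp add: sum_distrib_left mult_ac)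
    finally have local_error:
      "\<bar>v $ i - (M *\<^sub>v y) $ i\<bar> \<le> \<epsilon> * ?E * (\<Sum>j<n. \<bar>M $$ (i,j)\<bar> * ?q $ j)" .
    have "\<bar>(M *\<^sub>v y) $ i - (M *\<^sub>v (?P *\<^sub>v z)) $ i\<bar>
        = \<bar>\<Sum>j<n. M $$ (i,j) * (y $ j - (?P *\<^sub>v z) $ j)\<bar>"
      unfolding mult_mat_vec_entry[OF M y i] mult_mat_vec_entry[OF M Pz i]
      by (simp only: right_diff_distrib sum_subtractf)
    also have "\<dots> \<le> (\<Sum>j<n. \<bar>M $$ (i,j)\<bar> * \<bar>y $ j - (?P *\<^sub>v z) $ j\<bar>)"
      by (rule order.trans[OF sum_abs]) (simp add: abs_mult)
    also have "\<dots> \<le> (\<Sum>j<n. \<bar>M $$ (i,j)\<bar> * ((?E - 1) * ?q $ j))"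
      using IH by (intro sum_mono mult_left_mono) auto
    also have "\<dots> = (?E - 1) * (\<Sum>j<n. \<bar>M $$ (i,j)\<bar> * ?q $ j)"
      by (simp add: sum_distrib_left mult_ac)
    finally have inherited_error:
      "\<bar>(M *\<^sub>v y) $ i - (M *\<^sub>v (?P *\<^sub>v z)) $ i\<bar> \<le> (?E - 1) * (\<Sum>j<n. \<bar>M $$ (i,j)\<bar> * ?q $ j)" .
    have "\<bar>v $ i - (M *\<^sub>v (?P *\<^sub>v z)) $ i\<bar>
        \<le> \<epsilon> * ?E * (\<Sum>j<n. \<bar>M $$ (i,j)\<bar> * ?q $ j) + (?E - 1) * (\<Sum>j<n. \<bar>M $$ (i,j)\<bar> * ?q $ j)"
      using local_error inherited_error by linarith
    also have "\<dots> = ((1 + \<epsilon>) * ?E - 1) * (\<Sum>j<n. \<bar>M $$ (i,j)\<bar> * ?q $ j)"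
      by (simp add: algebra_simps)
    finally show ?thesis
      unfolding abs_mat_mult_vec_entry[OF M q i] .
  qed
  then show ?case
    using M P Q z by (auto simp: less_eq_vec_def assoc_mult_mat_vec[of _ n n _ n])
qed

section \<open>Sign patterns\<close>

text \<open>This says \<open>C = s D \<bar>C\<bar> D\<close> with \<open>D = diag f\<close>. It covers both sign hypotheses: a constant \<open>f\<close> gives the
nonnegative matrices (and their negatives), \<open>f i = (-1)^i\<close> the checkerboard ones.\<close>

definition sign_similar :: "(nat \<Rightarrow> real) \<Rightarrow> real mat \<Rightarrow> bool" where
  "sign_similar f C \<longleftrightarrow> (\<exists>s. \<bar>s\<bar> = 1 \<and>
     (\<forall>i < dim_row C. \<forall>j < dim_col C. C $$ (i,j) = s * f i * f j * \<bar>C $$ (i,j)\<bar>))"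

lemma square_eq_1_if_abs_eq_1: "\<bar>a::real\<bar> = 1 \<Longrightarrow> a * a = 1"
  by (metis abs_mult_self_eq mult_1)

text \<open>In \<open>D \<bar>M\<bar> D D \<bar>N\<bar> D\<close> the inner factor \<open>D D\<close> is the identity, so all terms of an entry of the product
have the same sign.\<close>

lemma sign_similar_mult:
  assumes M: "M \<in> carrier_mat n n" "sign_similar f M"
    and N: "N \<in> carrier_mat n n" "sign_similar f N"
    and f: "\<And>i. \<bar>f i\<bar> = 1"
  shows "sign_similar f (M * N)" and "abs_mat (M * N) = abs_mat M * abs_mat N"
proof -
  obtain s where s: "\<bar>s\<bar> = 1"
    "\<And>i j. i < n \<Longrightarrow> j < n \<Longrightarrow> M $$ (i,j) = s * f i * f j * \<bar>M $$ (i,j)\<bar>"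
    using M by (fastforce simp: sign_similar_def)
  obtain t where t: "\<bar>t\<bar> = 1"
    "\<And>i j. i < n \<Longrightarrow> j < n \<Longrightarrow> N $$ (i,j) = t * f i * f j * \<bar>N $$ (i,j)\<bar>"
    using N by (fastforce simp: sign_similar_def)
  let ?S = "\<lambda>i j. \<Sum>k<n. \<bar>M $$ (i,k)\<bar> * \<bar>N $$ (k,j)\<bar>"
  have entry: "(M * N) $$ (i,j) = s * t * f i * f j * ?S i j" if "i < n" "j < n" for i j
  proof -
    have "(M * N) $$ (i,j) = (\<Sum>k<n. M $$ (i,k) * N $$ (k,j))"
      using mult_mat_entry[OF M(1) N(1) that] .
    also have "\<dots> = (\<Sum>k<n. s * t * f i * f j * (\<bar>M $$ (i,k)\<bar> * \<bar>N $$ (k,j)\<bar>))"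
    proof (rule sum.cong)
      fix k assume "k \<in> {..<n}"
      then have "M $$ (i,k) * N $$ (k,j)
        = (s * f i * f k * \<bar>M $$ (i,k)\<bar>) * (t * f k * f j * \<bar>N $$ (k,j)\<bar>)"
        using s(2)[of i k] t(2)[of k j] that by simp
      also have "\<dots> = (f k * f k) * (s * t * f i * f j * (\<bar>M $$ (i,k)\<bar> * \<bar>N $$ (k,j)\<bar>))"
        by (simp only: mult_ac)
      finally show "M $$ (i,k) * N $$ (k,j) = s * t * f i * f j * (\<bar>M $$ (i,k)\<bar> * \<bar>N $$ (k,j)\<bar>)"
        using square_eq_1_if_abs_eq_1[OF f, of k] by simp
    qed simp
    finally show ?thesis by (simp add: sum_distrib_left)
  qed
  have abs_entry: "\<bar>(M * N) $$ (i,j)\<bar> = ?S i j" if "i < n" "j < n" for i j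
    unfolding entry[OF that] using s(1) t(1) f by (simp add: abs_mult sum_nonneg)
  show "sign_similar f (M * N)"
    unfolding sign_similar_def using entry abs_entry s(1) t(1) M N
    by (intro exI[of _ "s * t"]) (auto simp: abs_mult simp del: index_mult_mat(1))
  show "abs_mat (M * N) = abs_mat M * abs_mat N"
  proof (rule eq_matI)
    fix i j assume "i < dim_row (abs_mat M * abs_mat N)" "j < dim_col (abs_mat M * abs_mat N)"
    then have ij: "i < n" "j < n" using M N by auto
    have "abs_mat (M * N) $$ (i,j) = ?S i j"
      using abs_entry[OF ij] ij M N by simp
    also have "\<dots> = (abs_mat M * abs_mat N) $$ (i,j)"
      using ij M N by (subst mult_mat_entry[of _ n n _ n]) auto
    finally show "abs_mat (M * N) $$ (i,j) = (abs_mat M * abs_mat N) $$ (i,j)" .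
  qed (use M N in auto)
qed

lemma abs_mat_prod_sign_similar:
  assumes "\<And>M. M \<in> set Ms \<Longrightarrow> M \<in> carrier_mat n n \<and> sign_similar f M"
    and f: "\<And>i. \<bar>f i\<bar> = 1"
  shows "abs_mat (mat_prod n Ms) = mat_prod n (map abs_mat Ms)"
proof -
  have "sign_similar f (mat_prod n Ms) \<and> abs_mat (mat_prod n Ms) = mat_prod n (map abs_mat Ms)"
    using assms(1)
  proof (induction Ms)
    case Nil
    have "sign_similar f (1\<^sub>m n)"
      unfolding sign_similar_def
      using square_eq_1_if_abs_eq_1[OF f] by (intro exI[of _ 1]) auto
    moreover have "abs_mat (1\<^sub>m n) = 1\<^sub>m n" by (rule eq_matI) auto
    ultimately show ?case by simp
  next
    case (Cons M Ms)
    then show ?case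
      using sign_similar_mult[of M n f "mat_prod n Ms"] mat_prod_carrier[of Ms n] f by auto
  qed
  then show ?thesis by simp
qed

lemma nonneg_mat_sign_similar:
  assumes "nonneg_mat C"
  shows "sign_similar (\<lambda>i. 1) C"
proof -
  have "0 \<le> C $$ (i,j)" if "i < dim_row C" "j < dim_col C" for i j
    using assms that elements_matI[of C "dim_row C" "dim_col C" i j] by (auto simp: nonneg_mat_def)
  then show ?thesis
    unfolding sign_similar_def by (intro exI[of _ 1]) auto
qed

lemma checkerboard_sign_similar:
  assumes "checkerboard C" and C: "C \<in> carrier_mat n n"
  shows "sign_similar (\<lambda>i. (-1) ^ i) C"
proof -
  have S: "sign_mat n = mat_diag n (\<lambda>i. (-1) ^ i)"
    by (auto simp: sign_mat_def mat_diag_def)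
  have C': "abs_mat C \<in> carrier_mat n n" using C by simp
  have entry: "(sign_mat n * abs_mat C * sign_mat n) $$ (i,j) = (-1) ^ i * (-1) ^ j * \<bar>C $$ (i,j)\<bar>"
    if "i < n" "j < n" for i j
    using that C unfolding S
    by (simp add: mat_diag_mult_left[OF C'] mat_diag_mult_right[of _ n n] mult_ac)
  from assms consider "C = sign_mat n * abs_mat C * sign_mat n"
    | "C = - (sign_mat n * abs_mat C * sign_mat n)"
    by (auto simp: checkerboard_def Let_def)
  then show ?thesis
  proof cases
    case 1
    then have "C $$ (i,j) = (-1) ^ i * (-1) ^ j * \<bar>C $$ (i,j)\<bar>" if "i < n" "j < n" for i j
      using entry[OF that] by metis
    then show ?thesis
      unfolding sign_similar_def using C by (intro exI[of _ 1]) auto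
  next
    case 2
    have "C $$ (i,j) = - ((-1) ^ i * (-1) ^ j * \<bar>C $$ (i,j)\<bar>)" if "i < n" "j < n" for i j
    proof -
      have "C $$ (i,j) = (- (sign_mat n * abs_mat C * sign_mat n)) $$ (i,j)"
        using 2 by metis
      also have "\<dots> = - ((sign_mat n * abs_mat C * sign_mat n) $$ (i,j))"
        using that C by (intro index_uminus_mat) (auto simp: sign_mat_def)
      finally show ?thesis using entry[OF that] by simp
    qed
    then show ?thesis
      unfolding sign_similar_def using C by (intro exI[of _ "-1"]) auto
  qed
qed

section \<open>Inverse matrices\<close>

lemma inv_mat_eqI:
  assumes A: "A \<in> carrier_mat n n" and N: "N \<in> carrier_mat n n" "A * N = 1\<^sub>m n" "N * A = 1\<^sub>m n"
  shows "inv_mat A = N"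
proof -
  have "A \<in> Units (ring_mat TYPE(real) n ())"
    using A N by (auto simp: Units_def ring_mat_simps)
  then obtain C where "mat_inverse A = Some C"
    using mat_inverse(1)[OF A, where b = "()"] by (cases "mat_inverse A") auto
  then have C: "inv_mat A = C" "A * C = 1\<^sub>m n" "C \<in> carrier_mat n n"
    using mat_inverse(2)[OF A] by (auto simp: inv_mat_def)
  have "N = N * (A * C)" using C N by simp
  also have "\<dots> = (N * A) * C" by (rule assoc_mult_mat[symmetric, OF N(1) A C(3)])
  finally have "N = C" using C(3) N(3) by simp
  then show ?thesis using C(1) by simp
qed

lemma inv_mat_of_invertible:
  assumes A: "A \<in> carrier_mat n n" and inv: "invertible_mat A"
  shows "inv_mat A \<in> carrier_mat n n" "A * inv_mat A = 1\<^sub>m n" "inv_mat A * A = 1\<^sub>m n"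
proof -
  obtain N where N: "A * N = 1\<^sub>m n" "N * A = 1\<^sub>m (dim_row N)"
    using inv A by (auto simp: invertible_mat_def inverts_mat_def)
  have "dim_col N = n" using arg_cong[OF N(1), of dim_col] by simp
  moreover have "dim_row N = n" using arg_cong[OF N(2), of dim_col] A by simp
  ultimately have "N \<in> carrier_mat n n" by blast
  with N inv_mat_eqI[OF A this]
  show "inv_mat A \<in> carrier_mat n n" "A * inv_mat A = 1\<^sub>m n" "inv_mat A * A = 1\<^sub>m n"
    by auto
qed

lemma mat_prod_inverse:
  assumes "\<And>B. B \<in> set Bs \<Longrightarrow> B \<in> carrier_mat n n \<and> invertible_mat B"
  defines "N \<equiv> mat_prod n (map inv_mat (rev Bs))"
  shows "N \<in> carrier_mat n n" "mat_prod n Bs * N = 1\<^sub>m n" "N * mat_prod n Bs = 1\<^sub>m n"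
proof -
  have "N \<in> carrier_mat n n \<and> mat_prod n Bs * N = 1\<^sub>m n \<and> N * mat_prod n Bs = 1\<^sub>m n"
    using assms(1) unfolding N_def
  proof (induction Bs)
    case Nil
    then show ?case by simp
  next
    case (Cons B Bs)
    let ?P = "mat_prod n Bs" and ?N = "mat_prod n (map inv_mat (rev Bs))"
    have IH: "?N \<in> carrier_mat n n" "?P * ?N = 1\<^sub>m n" "?N * ?P = 1\<^sub>m n"
      using Cons by auto
    have B: "B \<in> carrier_mat n n" "invertible_mat B" using Cons.prems by auto
    note I = inv_mat_of_invertible[OF B]
    have P: "?P \<in> carrier_mat n n" using Cons.prems by (auto intro: mat_prod_carrier)
    have snoc: "mat_prod n (map inv_mat (rev (B # Bs))) = ?N * inv_mat B"
      using inv_mat_of_invertible(1) Cons.prems I(1)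
      by (simp, subst mat_prod_append) auto
    have "B * ?P * (?N * inv_mat B) = B * (?P * (?N * inv_mat B))"
      by (rule assoc_mult_mat[OF B(1) P mult_carrier_mat[OF IH(1) I(1)]])
    also have "\<dots> = B * (?P * ?N * inv_mat B)"
      by (simp only: assoc_mult_mat[OF P IH(1) I(1)])
    finally have "B * ?P * (?N * inv_mat B) = B * (?P * ?N * inv_mat B)" .
    moreover have "?N * inv_mat B * (B * ?P) = ?N * (inv_mat B * (B * ?P))"
      by (rule assoc_mult_mat[OF IH(1) I(1) mult_carrier_mat[OF B(1) P]])
    then have "?N * inv_mat B * (B * ?P) = ?N * (inv_mat B * B * ?P)"
      by (simp only: assoc_mult_mat[OF I(1) B(1) P])
    moreover have "?N * inv_mat B \<in> carrier_mat n n"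
      using IH(1) I(1) by (rule mult_carrier_mat)
    ultimately show ?case
      unfolding snoc mat_prod_Cons
      by (simp only: IH I left_mult_one_mat[OF I(1)] left_mult_one_mat[OF P] simp_thms)
  qed
  then show "N \<in> carrier_mat n n" "mat_prod n Bs * N = 1\<^sub>m n" "N * mat_prod n Bs = 1\<^sub>m n"
    by auto
qed

section \<open>One rounded elimination step\<close>

text \<open>The quotient \<open>z = (c - l y) / d\<close> with one relative error for each of the three operations. It is
stated for \<open>d z\<close> because both error bounds use this form.\<close>

definition rounded_quotient :: "real \<Rightarrow> real \<Rightarrow> real \<Rightarrow> real \<Rightarrow> real \<Rightarrow> real \<Rightarrow> bool" where
  "rounded_quotient u d l c y z \<longleftrightarrow>
     (\<exists>\<delta>1 \<delta>2 \<delta>3. \<bar>\<delta>1\<bar> \<le> u \<and> \<bar>\<delta>2\<bar> \<le> u \<and> \<bar>\<delta>3\<bar> \<le> u \<and>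
        d * z = (c - l * y * (1 + \<delta>1)) * (1 + \<delta>2) * (1 + \<delta>3))"

lemma rounded_quotient_fl:
  assumes "standard_model u F fl" and "c \<in> F" "l \<in> F" "y \<in> F" "d \<in> F" "d \<noteq> 0"
  shows "fl Div (fl Sub c (fl Mul l y)) d \<in> F"
    and "rounded_quotient u d l c y (fl Div (fl Sub c (fl Mul l y)) d)"
proof -
  have model: "fl op a b \<in> F \<and> (\<exists>\<delta>. \<bar>\<delta>\<bar> \<le> u \<and> fl op a b = exact op a b * (1 + \<delta>))"
    if "a \<in> F" "b \<in> F" "op = Div \<longrightarrow> b \<noteq> 0" for op a b
    using assms(1) that by (auto simp: standard_model_def)
  obtain \<delta>1 where m: "fl Mul l y \<in> F" "\<bar>\<delta>1\<bar> \<le> u" "fl Mul l y = l * y * (1 + \<delta>1)"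
    using model[of l y Mul] assms by auto
  obtain \<delta>2 where s: "fl Sub c (fl Mul l y) \<in> F" "\<bar>\<delta>2\<bar> \<le> u"
    "fl Sub c (fl Mul l y) = (c - fl Mul l y) * (1 + \<delta>2)"
    using model[of c "fl Mul l y" Sub] assms m by auto
  obtain \<delta>3 where q: "fl Div (fl Sub c (fl Mul l y)) d \<in> F" "\<bar>\<delta>3\<bar> \<le> u"
    "fl Div (fl Sub c (fl Mul l y)) d = fl Sub c (fl Mul l y) / d * (1 + \<delta>3)"
    using model[of "fl Sub c (fl Mul l y)" d Div] assms s by auto
  show "fl Div (fl Sub c (fl Mul l y)) d \<in> F" by (fact q(1))
  have "d * fl Div (fl Sub c (fl Mul l y)) d
      = (c - l * y * (1 + \<delta>1)) * (1 + \<delta>2) * (1 + \<delta>3)"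
    unfolding q(3) unfolding s(3) unfolding m(3) using \<open>d \<noteq> 0\<close> by simp
  then show "rounded_quotient u d l c y (fl Div (fl Sub c (fl Mul l y)) d)"
    unfolding rounded_quotient_def using m(2) s(2) q(2) by blast
qed

text \<open>The first unknown has no predecessor: its single division is the general step with \<open>l = y = 0\<close> and two
vanishing errors.\<close>

lemma rounded_quotient_fl_0:
  assumes "standard_model u F fl" and "c \<in> F" "d \<in> F" "d \<noteq> 0"
  shows "fl Div c d \<in> F" and "rounded_quotient u d 0 c 0 (fl Div c d)"
proof -
  obtain \<delta> where q: "fl Div c d \<in> F" "\<bar>\<delta>\<bar> \<le> u" "fl Div c d = c / d * (1 + \<delta>)"
    using assms unfolding standard_model_def by (metis exact.simps(4))
  have "0 \<le> u" using assms(1) by (simp add: standard_model_def)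
  show "fl Div c d \<in> F" by (fact q(1))
  show "rounded_quotient u d 0 c 0 (fl Div c d)"
    unfolding rounded_quotient_def
    by (rule exI[of _ 0], rule exI[of _ 0], rule exI[of _ \<delta>]) (use q \<open>0 \<le> u\<close> \<open>d \<noteq> 0\<close> in auto)
qed

text \<open>The errors of the subtraction and the division are charged to \<open>d z\<close>, as a factor \<open>1/p\<close> with
\<open>p = (1 + \<delta>2) (1 + \<delta>3)\<close> and \<open>\<bar>1 - 1/p\<bar> \<le> gamma2 u\<close>; the error of the multiplication stays with
\<open>l y\<close>, where \<open>u \<le> gamma2 u\<close> suffices.\<close>

lemma rounded_quotient_residual:
  assumes "rounded_quotient u d l c y z" and u: "0 \<le> u" "2 * u < 1"
  shows "\<bar>c - (d * z + l * y)\<bar> \<le> gamma2 u * (\<bar>d * z\<bar> + \<bar>l * y\<bar>)"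
proof -
  obtain \<delta>1 \<delta>2 \<delta>3 where \<delta>: "\<bar>\<delta>1\<bar> \<le> u" "\<bar>\<delta>2\<bar> \<le> u" "\<bar>\<delta>3\<bar> \<le> u"
    and z: "d * z = (c - l * y * (1 + \<delta>1)) * (1 + \<delta>2) * (1 + \<delta>3)"
    using assms(1) by (auto simp: rounded_quotient_def)
  define p where "p = (1 + \<delta>2) * (1 + \<delta>3)"
  define t where "t = c - l * y * (1 + \<delta>1)"
  have dz: "d * z = t * p" by (simp add: z p_def t_def)
  have "(1 - u) * (1 - u) \<le> p" "p \<le> (1 + u) * (1 + u)"
    unfolding p_def using \<delta> u by (auto intro!: mult_mono)
  then have p: "1 - 2 * u \<le> p" "p \<le> 1 + 2 * u + u * u"
    using mult_nonneg_nonneg[OF u(1) u(1)] unfolding distrib_left distrib_right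
      left_diff_distrib right_diff_distrib by linarith+
  \<comment> \<open>For \<open>p \<le> 1\<close> the worst case is \<open>p = 1 - 2 u\<close>. For \<open>p > 1\<close> the claim reads
    \<open>(1 - 4 u) p \<le> 1 - 2 u\<close>, where the left-hand side grows with \<open>p\<close> only if \<open>4 u \<le> 1\<close>.\<close>
  have "(1 - 2 * u) * \<bar>1 - p\<bar> \<le> 2 * u * p"
  proof (cases "p \<le> 1")
    case True
    then show ?thesis using p(1) by (simp add: abs_if algebra_simps)
  next
    case False
    have "(1 - 4 * u) * p \<le> 1 - 2 * u"
    proof (cases "4 * u \<le> 1")
      case True
      then have "(1 - 4 * u) * p \<le> (1 - 4 * u) * (1 + 2 * u + u * u)"
        using p(2) by (intro mult_left_mono) auto
      also have "\<dots> = 1 - 2 * u - 7 * (u * u) - 4 * (u * (u * u))" by (simp add: algebra_simps)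
      also have "\<dots> \<le> 1 - 2 * u"
      proof -
        have "0 \<le> u * u" "0 \<le> u * (u * u)" using u by auto
        then show ?thesis by linarith
      qed
      finally show ?thesis .
    next
      case False
      then have "(1 - 4 * u) * p \<le> 0" using p(1) u by (intro mult_nonpos_nonneg) auto
      then show ?thesis using u by simp
    qed
    then show ?thesis using False by (simp add: abs_if algebra_simps)
  qed
  then have "\<bar>1 - p\<bar> \<le> gamma2 u * p"
    using u by (simp add: gamma2_def field_simps)
  then have "\<bar>t\<bar> * \<bar>1 - p\<bar> \<le> \<bar>t\<bar> * (gamma2 u * p)" by (intro mult_left_mono) auto
  then have 1: "\<bar>t - d * z\<bar> \<le> gamma2 u * \<bar>d * z\<bar>"
    using p(1) u unfolding dz by (simp add: abs_mult[symmetric] right_diff_distrib) 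
       (simp add: abs_mult mult_ac)
  have "u \<le> gamma2 u"
    using u by (simp add: gamma2_def field_simps)
  then have 2: "\<bar>l * y * \<delta>1\<bar> \<le> gamma2 u * \<bar>l * y\<bar>"
    using \<delta>(1) by (simp add: abs_mult) (metis abs_ge_zero mult.commute mult_right_mono order.trans zero_le_mult_iff)
  have "c - (d * z + l * y) = (t - d * z) + l * y * \<delta>1" by (simp add: t_def algebra_simps)
  then show ?thesis using 1 2 by (simp add: distrib_left)
qed

lemma abs_mult_one_plus_diff_le:
  fixes p P \<delta> u :: real
  assumes "\<bar>p - 1\<bar> \<le> P - 1" and "\<bar>\<delta>\<bar> \<le> u"
  shows "\<bar>p * (1 + \<delta>) - 1\<bar> \<le> P * (1 + u) - 1"
proof -
  have "\<bar>p\<bar> * \<bar>\<delta>\<bar> \<le> P * u" using assms by (intro mult_mono) auto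
  moreover have "p * (1 + \<delta>) - 1 = (p - 1) + p * \<delta>" by (simp add: algebra_simps)
  ultimately show ?thesis
    using assms(1) abs_triangle_ineq[of "p - 1" "p * \<delta>"] by (simp add: abs_mult algebra_simps)
qed

text \<open>Here \<open>z0\<close> and \<open>y0\<close> are the exact values, and \<open>w'\<close> and \<open>w\<close> bound them and obey the same recursion with
all terms added in absolute value. The bound \<open>w\<close> for \<open>y0\<close> enters because the three new errors act on
\<open>y\<close> as the factor \<open>q\<close>, and \<open>y q - y0 = (y - y0) q + y0 (q - 1)\<close>. The data \<open>c\<close> meets only two errors;
\<open>1 \<le> (1 + u) E\<close> makes \<open>(1 + u)\<^sup>2\<close> at most the common factor \<open>E (1 + u)\<^sup>3\<close>, and it admits \<open>E = 1 / (1 + u)\<close>,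
with which the recursion starts.\<close>

lemma rounded_quotient_error:
  assumes "rounded_quotient u d l c y z" and "0 \<le> u" and "d \<noteq> 0"
    and exact: "d * z0 + l * y0 = c"
    and size: "\<bar>d\<bar> * w' = \<bar>c\<bar> + \<bar>l\<bar> * w" and y0: "\<bar>y0\<bar> \<le> w"
    and err: "\<bar>y - y0\<bar> \<le> (E - 1) * w" and E: "1 \<le> (1 + u) * E"
  shows "\<bar>z - z0\<bar> \<le> (E * (1 + u) ^ 3 - 1) * w'"
proof -
  obtain \<delta>1 \<delta>2 \<delta>3 where \<delta>: "\<bar>\<delta>1\<bar> \<le> u" "\<bar>\<delta>2\<bar> \<le> u" "\<bar>\<delta>3\<bar> \<le> u"
    and z: "d * z = (c - l * y * (1 + \<delta>1)) * (1 + \<delta>2) * (1 + \<delta>3)"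
    using assms(1) by (auto simp: rounded_quotient_def)
  define p where "p = (1 + \<delta>2) * (1 + \<delta>3)"
  define q where "q = p * (1 + \<delta>1)"
  let ?U = "E * (1 + u) ^ 3"
  have p: "\<bar>p - 1\<bar> \<le> (1 + u) * (1 + u) - 1"
    unfolding p_def by (rule abs_mult_one_plus_diff_le) (use \<delta> in auto)
  have q: "\<bar>q - 1\<bar> \<le> (1 + u) ^ 3 - 1"
    unfolding q_def using abs_mult_one_plus_diff_le[OF p \<delta>(1)] by (simp add: power3_eq_cube)
  have w: "0 \<le> w" using y0 by linarith
  have "1 * ((1 + u) * (1 + u)) \<le> ((1 + u) * E) * ((1 + u) * (1 + u))"
    using E \<open>0 \<le> u\<close> by (intro mult_right_mono) auto
  then have "\<bar>p - 1\<bar> \<le> ?U - 1" using p by (simp add: power3_eq_cube mult_ac)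
  then have c_part: "\<bar>c * (p - 1)\<bar> \<le> (?U - 1) * \<bar>c\<bar>"
    using mult_right_mono[of "\<bar>p - 1\<bar>" "?U - 1" "\<bar>c\<bar>"] by (simp add: abs_mult mult_ac)
  have "\<bar>y * q - y0\<bar> \<le> \<bar>y - y0\<bar> * \<bar>q\<bar> + \<bar>y0\<bar> * \<bar>q - 1\<bar>"
    using abs_triangle_ineq[of "(y - y0) * q" "y0 * (q - 1)"]
    by (simp add: abs_mult[symmetric] algebra_simps)
  also have "\<dots> \<le> ((E - 1) * w) * (1 + u) ^ 3 + w * ((1 + u) ^ 3 - 1)"
    using err y0 q w by (intro add_mono mult_mono) auto
  also have "\<dots> = (?U - 1) * w" by (simp add: algebra_simps)
  finally have "\<bar>l\<bar> * \<bar>y * q - y0\<bar> \<le> \<bar>l\<bar> * ((?U - 1) * w)"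
    by (intro mult_left_mono) auto
  then have y_part: "\<bar>l * (y * q - y0)\<bar> \<le> (?U - 1) * (\<bar>l\<bar> * w)"
    by (simp add: abs_mult mult_ac)
  have "d * (z - z0) = c * (p - 1) - l * (y * q - y0)"
    using z exact by (simp add: p_def q_def algebra_simps)
  then have "\<bar>d\<bar> * \<bar>z - z0\<bar> = \<bar>c * (p - 1) - l * (y * q - y0)\<bar>"
    by (metis abs_mult)
  also have "\<dots> \<le> (?U - 1) * (\<bar>c\<bar> + \<bar>l\<bar> * w)"
    using c_part y_part by (simp add: distrib_left)
  also have "\<dots> = \<bar>d\<bar> * ((?U - 1) * w')" by (simp flip: size)
  finally show ?thesis using \<open>d \<noteq> 0\<close> by simp
qed

section \<open>Bidiagonal matrices in elimination order\<close>

text \<open>The map \<open>r\<close> lists the unknowns in the order in which substitution computes them: increasing for lower,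
decreasing for upper bidiagonal matrices. In this order the matrix is lower bidiagonal in both cases.
Consecutive unknowns are neighbours, of which only the change of parity is recorded, since that is all
the sign pattern of the inverse depends on.\<close>

locale bidiagonal_elimination =
  fixes n :: nat and B N :: "real mat" and r :: "nat \<Rightarrow> nat"
  assumes B: "B \<in> carrier_mat n n" and N: "N \<in> carrier_mat n n" and BN: "B * N = 1\<^sub>m n"
    and order: "bij_betw r {..<n} {..<n}"
    and alternating: "\<And>i. Suc i < n \<Longrightarrow> (-1) ^ r (Suc i) = - ((-1) ^ r i :: real)"
    and zero: "\<And>i j. i < n \<Longrightarrow> j < n \<Longrightarrow> j \<noteq> i \<Longrightarrow> Suc j \<noteq> i \<Longrightarrow> B $$ (r i, r j) = 0"
begin

abbreviation d where "d i \<equiv> B $$ (r i, r i)"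
abbreviation l where "l i \<equiv> B $$ (r (Suc i), r i)"

lemma r_less [simp]: "i < n \<Longrightarrow> r i < n"
  using order by (auto simp: bij_betw_def)

lemma r_eq_iff: "i < n \<Longrightarrow> j < n \<Longrightarrow> r i = r j \<longleftrightarrow> i = j"
  using order by (auto simp: bij_betw_def inj_on_def)

lemma r_cases: assumes "q < n" obtains j where "j < n" "q = r j"
  using order assms by (auto simp: bij_betw_def)

text \<open>The function \<open>g\<close> is arbitrary so that the same formula evaluates \<open>B z\<close>, \<open>\<bar>B\<bar> \<bar>z\<bar>\<close> and a column of \<open>B N\<close>.\<close>

lemma row_sum:
  assumes i: "i < n" and g: "\<And>j. g j 0 = 0"
  shows "(\<Sum>j<n. g j (B $$ (r i, j)) :: real) =
    (case i of 0 \<Rightarrow> g (r 0) (d 0) | Suc k \<Rightarrow> g (r (Suc k)) (d (Suc k)) + g (r k) (l k))"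
proof -
  have "(\<Sum>j<n. g j (B $$ (r i, j))) = (\<Sum>j<n. g (r j) (B $$ (r i, r j)))"
    using sum.reindex_bij_betw[OF order, of "\<lambda>j. g j (B $$ (r i, j))"] by simp
  also have "\<dots> = (\<Sum>j\<in>{j. j < n \<and> (j = i \<or> Suc j = i)}. g (r j) (B $$ (r i, r j)))"
    using zero[OF i] g by (intro sum.mono_neutral_right) auto
  also have "{j. j < n \<and> (j = i \<or> Suc j = i)} = (case i of 0 \<Rightarrow> {0} | Suc k \<Rightarrow> {Suc k, k})"
    using i by (auto split: nat.splits)
  finally show ?thesis by (auto split: nat.splits)
qed

lemma inverse_column_0:
  assumes "0 < n" "q < n"
  shows "d 0 * N $$ (r 0, q) = (if r 0 = q then 1 else 0)"
  using row_sum[of 0 "\<lambda>j a. a * N $$ (j,q)"] mult_mat_entry[OF B N, of "r 0" q] assms BN by simp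

lemma inverse_column_Suc:
  assumes "Suc i < n" "q < n"
  shows "d (Suc i) * N $$ (r (Suc i), q) + l i * N $$ (r i, q) = (if r (Suc i) = q then 1 else 0)"
  using row_sum[of "Suc i" "\<lambda>j a. a * N $$ (j,q)"] mult_mat_entry[OF B N, of "r (Suc i)" q] assms BN
  by simp

lemma inverse_triangular:
  assumes "i < n"
  shows "d i \<noteq> 0 \<and> (\<forall>j<n. i < j \<longrightarrow> N $$ (r i, r j) = 0)"
  using assms
proof (induction i)
  case 0
  have "d 0 \<noteq> 0" using inverse_column_0[of "r 0"] 0 by auto
  moreover have "N $$ (r 0, r j) = 0" if "j < n" "0 < j" for j
    using inverse_column_0[of "r j"] 0 that calculation by (simp add: r_eq_iff)
  ultimately show ?case by blast
next
  case (Suc i)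
  have IH: "N $$ (r i, r j) = 0" if "j < n" "i < j" for j
    using Suc that by auto
  have "d (Suc i) \<noteq> 0"
    using inverse_column_Suc[of i "r (Suc i)"] IH[of "Suc i"] Suc.prems by auto
  moreover have "N $$ (r (Suc i), r j) = 0" if "j < n" "Suc i < j" for j
    using inverse_column_Suc[of i "r j"] IH[of j] Suc.prems that calculation
    by (simp add: r_eq_iff)
  ultimately show ?case by blast
qed

lemma d_nonzero: "i < n \<Longrightarrow> d i \<noteq> 0"
  using inverse_triangular by blast

text \<open>No cancellation occurs in the recursion for a column of the inverse, because the column starts at the
row of its diagonal entry: where the right-hand side is \<open>1\<close>, the preceding entry is \<open>0\<close>.\<close>

lemma abs_inverse_column_Suc:
  assumes "Suc i < n" "q < n"
  shows "\<bar>d (Suc i)\<bar> * \<bar>N $$ (r (Suc i), q)\<bar>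
    = (if r (Suc i) = q then 1 else 0) + \<bar>l i\<bar> * \<bar>N $$ (r i, q)\<bar>"
proof (cases "r (Suc i) = q")
  case True
  then have "N $$ (r i, q) = 0" using inverse_triangular[of i] assms by auto
  then show ?thesis
    using inverse_column_Suc[OF assms] True by (simp add: abs_mult[symmetric])
next
  case False
  then have "d (Suc i) * N $$ (r (Suc i), q) = - (l i * N $$ (r i, q))"
    using inverse_column_Suc[OF assms] by simp
  then show ?thesis using False by (simp flip: abs_mult)
qed

text \<open>The diagonal entries \<open>1 / d\<close> of the inverse have the sign \<open>s\<close> of \<open>d\<close>. Down a column, each step multiplies
by \<open>- l / d\<close>, whose sign is \<open>- f (r (i + 1)) f (r i)\<close>; the minus sign is the one that \<open>(-1)^i\<close> contributes
between neighbouring rows.\<close>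

lemma inverse_sign_similar:
  assumes "sign_similar f B" and f: "\<And>i. \<bar>f i\<bar> = 1"
  shows "sign_similar (\<lambda>i. f i * (-1) ^ i) N"
proof -
  let ?g = "\<lambda>i. f i * (-1) ^ i"
  obtain s where s: "\<bar>s\<bar> = 1"
    and B_eq: "\<And>i j. i < n \<Longrightarrow> j < n \<Longrightarrow> B $$ (i,j) = s * f i * f j * \<bar>B $$ (i,j)\<bar>"
    using assms B by (fastforce simp: sign_similar_def)
  note ff = square_eq_1_if_abs_eq_1[OF f]
  have ss: "s * s = 1" using s by (rule square_eq_1_if_abs_eq_1)
  have gg: "?g i * ?g i = 1" for i by (rule square_eq_1_if_abs_eq_1) (use f in \<open>simp add: abs_mult\<close>)
  have d_eq: "d i = s * \<bar>d i\<bar>" if "i < n" for i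
    using B_eq[of "r i" "r i"] that ff[of "r i"] by (simp add: mult.assoc)
  have "N $$ (r i, q) = s * ?g (r i) * ?g q * \<bar>N $$ (r i, q)\<bar>" if "i < n" "q < n" for i q
    using that
  proof (induction i)
    case 0
    then have col: "d 0 * N $$ (r 0, q) = (if r 0 = q then 1 else 0)" by (intro inverse_column_0)
    show ?case
    proof (cases "r 0 = q")
      case True
      have "\<bar>d 0\<bar> * \<bar>N $$ (r 0, q)\<bar> = 1" using col True by (simp flip: abs_mult)
      then have "d 0 * N $$ (r 0, q) = d 0 * (s * \<bar>N $$ (r 0, q)\<bar>)"
        using col True d_eq[OF 0(1)] ss by (metis mult.assoc mult.left_commute mult_1)
      then have "N $$ (r 0, q) = s * \<bar>N $$ (r 0, q)\<bar>" using d_nonzero[OF 0(1)] by simp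
      then show ?thesis using True gg[of q] by (simp add: mult.assoc)
    next
      case False
      then show ?thesis using col d_nonzero[OF 0(1)] by simp
    qed
  next
    case (Suc i)
    note col = inverse_column_Suc[OF Suc.prems] and acol = abs_inverse_column_Suc[OF Suc.prems]
    show ?case
    proof (cases "r (Suc i) = q")
      case True
      then have "N $$ (r i, q) = 0" using inverse_triangular[of i] Suc.prems by auto
      then have col': "d (Suc i) * N $$ (r (Suc i), q) = 1" using col True by simp
      then have "\<bar>d (Suc i)\<bar> * \<bar>N $$ (r (Suc i), q)\<bar> = 1" by (simp flip: abs_mult)
      then have "d (Suc i) * N $$ (r (Suc i), q) = d (Suc i) * (s * \<bar>N $$ (r (Suc i), q)\<bar>)"
        using col' d_eq[OF Suc.prems(1)] ss by (metis mult.assoc mult.left_commute mult_1)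
      then have "N $$ (r (Suc i), q) = s * \<bar>N $$ (r (Suc i), q)\<bar>"
        using d_nonzero[OF Suc.prems(1)] by simp
      then show ?thesis using True gg[of q] by (simp add: mult.assoc)
    next
      case False
      let ?F = "f (r (Suc i)) * f (r i)"
      have g: "?g (r (Suc i)) = - ?F * ?g (r i)"
        using alternating[OF Suc.prems(1)] ff[of "r i"] by simp
      have l_eq: "l i = s * ?F * \<bar>l i\<bar>"
        using B_eq[of "r (Suc i)" "r i"] Suc.prems by (simp add: mult.assoc)
      have IH: "N $$ (r i, q) = s * ?g (r i) * ?g q * \<bar>N $$ (r i, q)\<bar>"
        using Suc by simp
      have "d (Suc i) * N $$ (r (Suc i), q) = - (l i * N $$ (r i, q))"
        using col False by simp
      also have "\<dots> = - ((s * ?F * \<bar>l i\<bar>) * (s * ?g (r i) * ?g q * \<bar>N $$ (r i, q)\<bar>))"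
        using l_eq IH by metis
      also have "\<dots> = s * (s * (- ?F * ?g (r i)) * ?g q) * (\<bar>l i\<bar> * \<bar>N $$ (r i, q)\<bar>)"
        by (simp add: mult_ac)
      also have "\<dots> = s * (s * ?g (r (Suc i)) * ?g q) * (\<bar>d (Suc i)\<bar> * \<bar>N $$ (r (Suc i), q)\<bar>)"
        unfolding g using acol False by simp
      also have "\<dots> = (s * \<bar>d (Suc i)\<bar>) * (s * ?g (r (Suc i)) * ?g q * \<bar>N $$ (r (Suc i), q)\<bar>)"
        by (simp add: mult_ac)
      also have "\<dots> = d (Suc i) * (s * ?g (r (Suc i)) * ?g q * \<bar>N $$ (r (Suc i), q)\<bar>)"
        using d_eq[OF Suc.prems(1)] by simp
      finally show ?thesis using d_nonzero[OF Suc.prems(1)] by simp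
    qed
  qed
  note rows = this
  have "N $$ (p, q) = s * ?g p * ?g q * \<bar>N $$ (p, q)\<bar>" if "p < n" "q < n" for p q
    by (rule r_cases[OF that(1)]) (use rows that in \<open>simp del: index_mult_mat_vec\<close>)
  then show ?thesis
    unfolding sign_similar_def using s N by (intro exI[of _ s]) auto
qed

end

text \<open>The vector \<open>z\<close> is what the substitution returns for the right-hand side \<open>c\<close>. Only the rounding errors are
recorded, not the rounding function.\<close>

locale rounded_elimination = bidiagonal_elimination +
  fixes u :: real and c z :: "real vec"
  assumes u: "0 \<le> u" "2 * u < 1"
    and c: "c \<in> carrier_vec n" and z: "z \<in> carrier_vec n"
    and z_0: "0 < n \<Longrightarrow> rounded_quotient u (d 0) 0 (c $ r 0) 0 (z $ r 0)"
    and z_Suc: "\<And>i. Suc i < n \<Longrightarrow>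
      rounded_quotient u (d (Suc i)) (l i) (c $ r (Suc i)) (z $ r i) (z $ r (Suc i))"
begin

lemma residual: "abs_vec (c - B *\<^sub>v z) \<le> gamma2 u \<cdot>\<^sub>v (abs_mat B *\<^sub>v abs_vec z)"
proof -
  have "\<bar>c $ r i - (\<Sum>j<n. B $$ (r i, j) * z $ j)\<bar>
      \<le> gamma2 u * (\<Sum>j<n. \<bar>B $$ (r i, j)\<bar> * \<bar>z $ j\<bar>)" if i: "i < n" for i
  proof (cases i)
    case 0
    then show ?thesis
      using rounded_quotient_residual[OF z_0 u] i
        row_sum[OF i, of "\<lambda>j a. a * z $ j"] row_sum[OF i, of "\<lambda>j a. \<bar>a\<bar> * \<bar>z $ j\<bar>"]
      by (simp add: abs_mult)
  next
    case (Suc k)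
    then show ?thesis
      using rounded_quotient_residual[OF z_Suc u, of k] i
        row_sum[OF i, of "\<lambda>j a. a * z $ j"] row_sum[OF i, of "\<lambda>j a. \<bar>a\<bar> * \<bar>z $ j\<bar>"]
      by (simp add: abs_mult)
  qed
  note rows = this
  have "\<bar>c $ p - (\<Sum>j<n. B $$ (p, j) * z $ j)\<bar>
      \<le> gamma2 u * (\<Sum>j<n. \<bar>B $$ (p, j)\<bar> * \<bar>z $ j\<bar>)" if "p < n" for p
    by (rule r_cases[OF that(1)]) (use rows that in \<open>simp del: index_mult_mat_vec\<close>)
  then show ?thesis
    using B z c mult_mat_vec_entry[OF B z] abs_mat_mult_vec_entry[OF B, of "abs_vec z"]
    by (auto simp: less_eq_vec_def simp del: index_mult_mat_vec)
qed

text \<open>The error is measured against \<open>w = \<bar>N\<bar> \<bar>c\<bar>\<close>. This vector dominates the exact solution \<open>N c\<close>, and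
\<open>abs_inverse_column_Suc\<close> gives it the recursion that \<open>rounded_quotient_error\<close> asks for.\<close>

lemma forward_error_power:
  assumes "i < n"
  shows "\<bar>z $ r i - (N *\<^sub>v c) $ r i\<bar>
    \<le> ((1 + u) ^ (3 * i + 2) - 1) * (abs_mat N *\<^sub>v abs_vec c) $ r i"
proof -
  define y where "y = N *\<^sub>v c"
  define w where "w = abs_mat N *\<^sub>v abs_vec c"
  have y: "y \<in> carrier_vec n" using N c by (simp add: y_def)
  have w: "w $ p = (\<Sum>q<n. \<bar>N $$ (p,q)\<bar> * \<bar>c $ q\<bar>)" if "p < n" for p
    using abs_mat_mult_vec_entry[OF N, of "abs_vec c"] c that by (simp add: w_def)
  have "B *\<^sub>v y = c"
    using assoc_mult_mat_vec[OF B N c] BN c by (simp add: y_def)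
  then have By: "(\<Sum>j<n. B $$ (p,j) * y $ j) = c $ p" if "p < n" for p
    using mult_mat_vec_entry[OF B y that] by simp
  have y_le: "\<bar>y $ p\<bar> \<le> w $ p" if "p < n" for p
    using abs_mult_mat_vec_entry_le[OF N c that] w[OF that] by (simp add: y_def)
  have "\<bar>z $ r i - y $ r i\<bar> \<le> ((1 + u) ^ (3 * i + 2) - 1) * w $ r i"
    using assms
  proof (induction i)
    case 0
    have "\<bar>d 0\<bar> * w $ r 0 = (\<Sum>q<n. \<bar>d 0 * N $$ (r 0, q)\<bar> * \<bar>c $ q\<bar>)"
      using 0 by (simp add: w sum_distrib_left abs_mult mult.assoc)
    also have "\<dots> = (\<Sum>q<n. if q = r 0 then \<bar>c $ q\<bar> else 0)"
      using inverse_column_0 0 by (intro sum.cong) auto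
    finally have size: "\<bar>d 0\<bar> * w $ r 0 = \<bar>c $ r 0\<bar> + \<bar>0\<bar> * 0" using 0 by simp
    have exact: "d 0 * y $ r 0 + 0 * 0 = c $ r 0"
      using row_sum[OF 0, of "\<lambda>j a. a * y $ j"] By 0 by simp
    \<comment> \<open>With no predecessor, \<open>E = 1 / (1 + u)\<close> turns the factor \<open>E (1 + u)\<^sup>3\<close> into \<open>(1 + u)\<^sup>2\<close>.\<close>
    have "\<bar>z $ r 0 - y $ r 0\<bar> \<le> (1 / (1 + u) * (1 + u) ^ 3 - 1) * w $ r 0"
      using u by (intro rounded_quotient_error[OF z_0[OF 0] u(1) d_nonzero[OF 0] exact size]) auto
    then show ?case using u(1) by (simp add: power3_eq_cube power2_eq_square)
  next
    case (Suc i)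
    have "\<bar>d (Suc i)\<bar> * w $ r (Suc i)
        = (\<Sum>q<n. (\<bar>d (Suc i)\<bar> * \<bar>N $$ (r (Suc i), q)\<bar>) * \<bar>c $ q\<bar>)"
      using Suc.prems by (simp add: w sum_distrib_left mult.assoc)
    also have "\<dots> = (\<Sum>q<n. (if q = r (Suc i) then \<bar>c $ q\<bar> else 0)
        + \<bar>l i\<bar> * (\<bar>N $$ (r i, q)\<bar> * \<bar>c $ q\<bar>))"
      using abs_inverse_column_Suc[OF Suc.prems]
      by (intro sum.cong) (auto simp: distrib_right)
    finally have size: "\<bar>d (Suc i)\<bar> * w $ r (Suc i) = \<bar>c $ r (Suc i)\<bar> + \<bar>l i\<bar> * w $ r i"
      using Suc.prems by (simp add: w sum.distrib sum_distrib_left)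
    have exact: "d (Suc i) * y $ r (Suc i) + l i * y $ r i = c $ r (Suc i)"
      using row_sum[OF Suc.prems, of "\<lambda>j a. a * y $ j"] By Suc.prems by simp
    have "1 * 1 \<le> (1 + u) * (1 + u) ^ (3 * i + 2)"
      using u(1) by (intro mult_mono one_le_power) auto
    then have "\<bar>z $ r (Suc i) - y $ r (Suc i)\<bar>
        \<le> ((1 + u) ^ (3 * i + 2) * (1 + u) ^ 3 - 1) * w $ r (Suc i)"
      using Suc y_le[of "r i"]
      by (intro rounded_quotient_error[OF z_Suc u(1) d_nonzero exact size]) auto
    moreover have "(1 + u) ^ (3 * i + 2) * (1 + u) ^ 3 = (1 + u) ^ (3 * Suc i + 2)"
      unfolding power_add[symmetric] by (rule arg_cong[where f = "power (1 + u)"]) simp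
    ultimately show ?case by simp
  qed
  then show ?thesis by (simp add: y_def w_def)
qed

end

text \<open>Since \<open>3 n - 1 \<le> 2 (2 n - 1)\<close> and \<open>(1 + u)\<^sup>2 \<le> 1 + g\<close> for \<open>g = gamma2 u\<close>, the left-hand side is at most
\<open>(1 + g)^m\<close> with \<open>m = 2 n - 1\<close>. Bernoulli's inequality \<open>1 - m g \<le> (1 - g)^m\<close> and \<open>(1 + g) (1 - g) \<le> 1\<close>
bound this by \<open>1 / (1 - m g) = 1 + tau n u\<close>.\<close>

lemma one_plus_power_le_tau:
  assumes "0 \<le> u" "2 * u < 1" "1 \<le> n" "(2 * real n - 1) * gamma2 u < 1"
  shows "(1 + u) ^ (3 * n - 1) \<le> 1 + tau n u"
proof -
  define g where "g = gamma2 u"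
  define m where "m = 2 * n - 1"
  have m: "real m = 2 * real n - 1" using assms(3) by (simp add: m_def of_nat_diff)
  have g: "0 \<le> g" "real m * g < 1" using assms unfolding m by (auto simp: g_def gamma2_def)
  have "1 \<le> real m" using assms(3) m by simp
  then have "1 * g \<le> real m * g" using g(1) by (intro mult_right_mono)
  then have "g < 1" using g by simp
  have "((1 + u) ^ 2) * (1 - 2 * u) = 1 - 3 * (u * u) - 2 * (u * (u * u))"
    by (simp add: power2_eq_square algebra_simps)
  also have "\<dots> \<le> 1"
  proof -
    have "0 \<le> u * u" "0 \<le> u * (u * u)" using assms(1) by auto
    then show ?thesis by linarith
  qed
  finally have sq: "(1 + u) ^ 2 \<le> 1 + g"
    using assms(2) by (simp add: g_def gamma2_def field_simps)
  have "(1 + u) ^ (3 * n - 1) \<le> (1 + u) ^ (2 * m)"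
    using assms(1,3) by (intro power_increasing) (auto simp: m_def)
  also have "\<dots> = ((1 + u) ^ 2) ^ m" by (simp add: power_mult)
  also have "\<dots> \<le> (1 + g) ^ m" using sq assms(1) by (intro power_mono) auto
  also have "\<dots> \<le> 1 / (1 - real m * g)"
  proof -
    have "1 - real m * g \<le> (1 - g) ^ m"
      using Bernoulli_inequality[of "-g" m] \<open>g < 1\<close> by simp
    then have "(1 + g) ^ m * (1 - real m * g) \<le> (1 + g) ^ m * (1 - g) ^ m"
      using g(1) by (intro mult_left_mono) auto
    also have "\<dots> = (1 - g * g) ^ m" by (simp flip: power_mult_distrib add: algebra_simps)
    also have "\<dots> \<le> 1" using g(1) \<open>g < 1\<close> by (intro power_le_one) (auto intro: mult_le_one)
    finally show ?thesis using g(2) by (simp add: field_simps)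
  qed
  also have "\<dots> = 1 + tau n u"
    using g(2) by (simp add: tau_def m g_def field_simps)
  finally show ?thesis .
qed

lemma (in rounded_elimination) forward_error:
  assumes "(2 * real n - 1) * gamma2 u < 1"
  shows "abs_vec (z - N *\<^sub>v c) \<le> tau n u \<cdot>\<^sub>v (abs_mat N *\<^sub>v abs_vec c)"
proof -
  have "\<bar>z $ r i - (N *\<^sub>v c) $ r i\<bar> \<le> tau n u * (abs_mat N *\<^sub>v abs_vec c) $ r i" if "i < n" for i
  proof -
    have "0 \<le> (abs_mat N *\<^sub>v abs_vec c) $ r i"
      using abs_mat_mult_vec_entry[OF N, of "abs_vec c" "r i"] c that
      by (simp add: sum_nonneg del: index_mult_mat_vec)
    moreover have "(1 + u) ^ (3 * i + 2) \<le> (1 + u) ^ (3 * n - 1)"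
      using u(1) that by (intro power_increasing) auto
    then have "(1 + u) ^ (3 * i + 2) - 1 \<le> tau n u"
      using one_plus_power_le_tau[OF u _ assms] that by simp
    ultimately show ?thesis
      using forward_error_power[OF that] by (meson mult_right_mono order.trans)
  qed
  note rows = this
  have "\<bar>z $ p - (N *\<^sub>v c) $ p\<bar> \<le> tau n u * (abs_mat N *\<^sub>v abs_vec c) $ p" if "p < n" for p
    by (rule r_cases[OF that(1)]) (use rows that in \<open>simp del: index_mult_mat_vec\<close>)
  then show ?thesis
    using N z c by (auto simp: less_eq_vec_def)
qed

section \<open>Substitution as elimination in one of two orders\<close>

lemma lower_bidiagonal_elimination:
  assumes B: "B \<in> carrier_mat n n" and "invertible_mat B" and "lower_bidiagonal B"
  shows "bidiagonal_elimination n B (inv_mat B) (\<lambda>i. i)"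
proof (unfold_locales)
  show "B $$ (i, j) = 0" if "i < n" "j < n" "j \<noteq> i" "Suc j \<noteq> i" for i j
    using assms that by (auto simp: lower_bidiagonal_def upper_bidiagonal_def)
qed (use assms inv_mat_of_invertible[OF assms(1,2)] in \<open>auto simp: bij_betw_def\<close>)

lemma upper_bidiagonal_elimination:
  assumes B: "B \<in> carrier_mat n n" and "invertible_mat B" and "upper_bidiagonal B"
  shows "bidiagonal_elimination n B (inv_mat B) (\<lambda>i. n - 1 - i)"
proof (unfold_locales)
  show "bij_betw (\<lambda>i. n - 1 - i) {..<n} {..<n}"
    by (rule bij_betw_byWitness[where f' = "\<lambda>i. n - 1 - i"]) auto
  show "(-1) ^ (n - 1 - Suc i) = - ((-1) ^ (n - 1 - i) :: real)" if "Suc i < n" for i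
  proof -
    have "n - 1 - i = Suc (n - 1 - Suc i)" using that by simp
    then show ?thesis by simp
  qed
  show "B $$ (n - 1 - i, n - 1 - j) = 0" if "i < n" "j < n" "j \<noteq> i" "Suc j \<noteq> i" for i j
  proof -
    have "n - 1 - j \<noteq> n - 1 - i" "n - 1 - j \<noteq> Suc (n - 1 - i)" using that by linarith+
    moreover have "n - 1 - i < n" "n - 1 - j < n" using that by linarith+
    moreover have "\<forall>p<n. \<forall>q<n. q \<noteq> p \<and> q \<noteq> Suc p \<longrightarrow> B $$ (p, q) = 0"
      using assms(3) carrier_matD[OF B] by (simp add: upper_bidiagonal_def)
    ultimately show ?thesis by blast
  qed
qed (use assms inv_mat_of_invertible[OF assms(1,2)] in auto)

text \<open>The model speaks only about operations on floating-point numbers, so it has to be carried along that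
all computed entries \<open>e\<close> belong to \<open>F\<close>.\<close>

lemma substitution_rounded_elimination:
  fixes e :: "nat \<Rightarrow> real"
  assumes "bidiagonal_elimination n B N r"
    and model: "standard_model u F fl" and u: "2 * u < 1"
    and BF: "elements_mat B \<subseteq> F" and c: "c \<in> carrier_vec n" and cF: "set\<^sub>v c \<subseteq> F"
    and e_0: "0 < n \<Longrightarrow> e (r 0) = fl Div (c $ r 0) (B $$ (r 0, r 0))"
    and e_Suc: "\<And>i. Suc i < n \<Longrightarrow> e (r (Suc i)) =
      fl Div (fl Sub (c $ r (Suc i)) (fl Mul (B $$ (r (Suc i), r i)) (e (r i))))
        (B $$ (r (Suc i), r (Suc i)))"
  shows "set\<^sub>v (vec n e) \<subseteq> F" and "rounded_elimination n B N r u c (vec n e)"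
proof -
  interpret bidiagonal_elimination n B N r by fact
  have cF: "c $ i \<in> F" if "i < n" for i using cF c that by (auto simp: vec_set_def)
  have BF: "B $$ (i,j) \<in> F" if "i < n" "j < n" for i j using BF B that by blast
  have eF: "e (r i) \<in> F" if "i < n" for i
    using that
  proof (induction i)
    case 0
    then show ?case using rounded_quotient_fl_0(1)[OF model cF BF d_nonzero] e_0 by simp
  next
    case (Suc i)
    then show ?case
      using rounded_quotient_fl(1)[OF model cF BF _ BF d_nonzero, of "r (Suc i)" _ "r i" "e (r i)"]
        e_Suc by simp
  qed
  then show "set\<^sub>v (vec n e) \<subseteq> F"
    by (auto simp: vec_set_def) (metis r_cases)
  show "rounded_elimination n B N r u c (vec n e)"
  proof unfold_locales
    show "0 \<le> u" using model by (simp add: standard_model_def)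
    show "rounded_quotient u (d 0) 0 (c $ r 0) 0 (vec n e $ r 0)" if "0 < n"
      using rounded_quotient_fl_0(2)[OF model cF BF d_nonzero] e_0 that by simp
    show "rounded_quotient u (d (Suc i)) (l i) (c $ r (Suc i)) (vec n e $ r i) (vec n e $ r (Suc i))"
      if "Suc i < n" for i
      using rounded_quotient_fl(2)[OF model cF BF eF BF d_nonzero] e_Suc that by simp
  qed (use u c in auto)
qed

lemma bidiagonal_solve_error:
  assumes B: "B \<in> carrier_mat n n" "invertible_mat B"
    and model: "standard_model u F fl" and u: "2 * u < 1" "(2 * real n - 1) * gamma2 u < 1"
    and BF: "elements_mat B \<subseteq> F" and c: "c \<in> carrier_vec n" and cF: "set\<^sub>v c \<subseteq> F"
    and solve: "bidiagonal_solve fl B c z"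
  shows "z \<in> carrier_vec n" and "set\<^sub>v z \<subseteq> F"
    and "abs_vec (c - B *\<^sub>v z) \<le> gamma2 u \<cdot>\<^sub>v (abs_mat B *\<^sub>v abs_vec z)"
    and "abs_vec (z - inv_mat B *\<^sub>v c) \<le> tau n u \<cdot>\<^sub>v (abs_mat (inv_mat B) *\<^sub>v abs_vec c)"
proof -
  have "\<exists>r. set\<^sub>v z \<subseteq> F \<and> rounded_elimination n B (inv_mat B) r u c z"
  proof (cases "upper_bidiagonal B \<and> z = back_subst fl B c")
    case True
    then have z: "z = vec n (back_entry fl B c)" using c by (simp add: back_subst_def)
    have step: "back_entry fl B c (n - 1 - Suc i) =
        fl Div (fl Sub (c $ (n - 1 - Suc i))
          (fl Mul (B $$ (n - 1 - Suc i, n - 1 - i)) (back_entry fl B c (n - 1 - i))))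
        (B $$ (n - 1 - Suc i, n - 1 - Suc i))" if "Suc i < n" for i
    proof -
      have "Suc (n - 1 - Suc i) = n - 1 - i" using that by simp
      then show ?thesis using that c by (subst back_entry.simps) simp
    qed
    have start: "back_entry fl B c (n - 1 - 0) = fl Div (c $ (n - 1 - 0)) (B $$ (n - 1 - 0, n - 1 - 0))"
    proof -
      have "\<not> Suc (n - 1 - 0) < dim_vec c" using c by simp
      then show ?thesis by (subst back_entry.simps) (rule if_not_P)
    qed
    show ?thesis
      using substitution_rounded_elimination[OF upper_bidiagonal_elimination[OF B] model u(1) BF c cF,
          of "back_entry fl B c"] True start step
      unfolding z by blast
  next
    case False
    then have lower: "lower_bidiagonal B" and z: "z = vec n (forward_entry fl B c)"
      using solve c by (auto simp: bidiagonal_solve_def forward_subst_def)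
    show ?thesis
      using substitution_rounded_elimination[OF lower_bidiagonal_elimination[OF B lower]
          model u(1) BF c cF, of "forward_entry fl B c"]
      unfolding z by auto
  qed
  then obtain r where "set\<^sub>v z \<subseteq> F" and run: "rounded_elimination n B (inv_mat B) r u c z" by blast
  interpret rounded_elimination n B "inv_mat B" r u c z by (fact run)
  show "z \<in> carrier_vec n" by (fact z)
  show "set\<^sub>v z \<subseteq> F" by (fact \<open>set\<^sub>v z \<subseteq> F\<close>)
  show "abs_vec (c - B *\<^sub>v z) \<le> gamma2 u \<cdot>\<^sub>v (abs_mat B *\<^sub>v abs_vec z)" by (rule residual)
  show "abs_vec (z - inv_mat B *\<^sub>v c) \<le> tau n u \<cdot>\<^sub>v (abs_mat (inv_mat B) *\<^sub>v abs_vec c)"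
    by (rule forward_error) (fact \<open>(2 * real n - 1) * gamma2 u < 1\<close>)
qed

lemma inv_mat_sign_similar:
  assumes "B \<in> carrier_mat n n" "invertible_mat B" "upper_bidiagonal B \<or> lower_bidiagonal B"
    and "sign_similar f B" "\<And>i. \<bar>f i\<bar> = 1"
  shows "sign_similar (\<lambda>i. f i * (-1) ^ i) (inv_mat B)"
  using assms(3)
proof
  assume "upper_bidiagonal B"
  from bidiagonal_elimination.inverse_sign_similar[OF
      upper_bidiagonal_elimination[OF assms(1,2) this] assms(4,5)] show ?thesis .
next
  assume "lower_bidiagonal B"
  from bidiagonal_elimination.inverse_sign_similar[OF
      lower_bidiagonal_elimination[OF assms(1,2) this] assms(4,5)] show ?thesis .
qed

text \<open>The forward error of one system, \<open>\<bar>y - B\<^sup>-\<^sup>1 c\<bar> \<le> tau n u \<bar>B\<^sup>-\<^sup>1\<bar> \<bar>c\<bar>\<close>, is a link from the computed solution \<open>y\<close>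
back to the right-hand side \<open>c\<close>. This is why the second chain runs through the inverses in reverse order.\<close>

lemma successive_solve_chains:
  assumes "\<And>B. B \<in> set Bs \<Longrightarrow> B \<in> carrier_mat n n \<and> invertible_mat B \<and> elements_mat B \<subseteq> F"
    and model: "standard_model u F fl" and u: "2 * u < 1" "(2 * real n - 1) * gamma2 u < 1"
    and "b \<in> carrier_vec n" "set\<^sub>v b \<subseteq> F" "successive_solve fl Bs b z"
  shows "z \<in> carrier_vec n \<and> perturbed_chain n (gamma2 u) Bs b z
    \<and> perturbed_chain n (tau n u) (map inv_mat (rev Bs)) z b"
  using assms(1,5-7)
proof (induction Bs arbitrary: b)
  case Nil
  then show ?case by simp
next
  case (Cons B Bs)
  then obtain y where y: "bidiagonal_solve fl B b y" "successive_solve fl Bs y z" by auto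
  have "B \<in> carrier_mat n n" "invertible_mat B" "elements_mat B \<subseteq> F"
    using Cons.prems(1) by auto
  note err = bidiagonal_solve_error[OF this(1,2) model u this(3) Cons.prems(2,3) y(1)]
  have IH: "z \<in> carrier_vec n" "perturbed_chain n (gamma2 u) Bs y z"
    "perturbed_chain n (tau n u) (map inv_mat (rev Bs)) z y"
    using Cons.IH[OF Cons.prems(1) err(1,2) y(2)] by auto
  show ?case
    using IH err perturbed_chain_snoc[OF IH(3) err(1) Cons.prems(2) err(4)] by auto
qed

section \<open>First-order expansion of the error constants\<close>

text \<open>The difference equals \<open>a c v\<^sup>2 / (1 - c v)\<close>, and \<open>1 - c v > 1/2\<close> near \<open>0\<close>.\<close>

lemma geometric_expansion:
  "(\<lambda>v. a * v / (1 - c * v) - a * v) \<in> O[at_right 0](\<lambda>v::real. v\<^sup>2)"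
proof (rule bigoI[of _ "2 * \<bar>a * c\<bar>"])
  have "((\<lambda>v. 1 - c * v) \<longlongrightarrow> 1 - c * 0) (at_right 0)" by (intro tendsto_intros)
  then have "\<forall>\<^sub>F v in at_right 0. 1 - c * v > 1 / 2" by (rule order_tendstoD) simp
  then show "\<forall>\<^sub>F v in at_right 0. norm (a * v / (1 - c * v) - a * v) \<le> 2 * \<bar>a * c\<bar> * norm (v\<^sup>2)"
  proof eventually_elim
    case (elim v)
    have "a * v / (1 - c * v) - a * v = a * c * v\<^sup>2 * (1 / (1 - c * v))"
      using elim by (simp add: field_simps power2_eq_square)
    moreover have "\<bar>1 / (1 - c * v)\<bar> \<le> 2" using elim by (simp add: field_simps)
    ultimately have "norm (a * v / (1 - c * v) - a * v) \<le> \<bar>a * c * v\<^sup>2\<bar> * 2"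
      using mult_left_mono[of "\<bar>1 / (1 - c * v)\<bar>" 2 "\<bar>a * c * v\<^sup>2\<bar>"] by (simp add: abs_mult)
    then show ?case by (simp add: abs_mult mult_ac)
  qed
qed

text \<open>If \<open>R\<^sub>k\<close> denotes the remainder, then \<open>R\<^sub>k\<^sub>+\<^sub>1 = R\<^sub>k (1 + f) + k a v f + (f - a v)\<close>, in which each summand is of
second order.\<close>

lemma power_expansion:
  fixes f :: "real \<Rightarrow> real"
  assumes f: "(\<lambda>v. f v - a * v) \<in> O[at_right 0](\<lambda>v. v\<^sup>2)"
  shows "(\<lambda>v. (1 + f v) ^ k - 1 - real k * a * v) \<in> O[at_right 0](\<lambda>v. v\<^sup>2)"
proof -
  have v1: "(\<lambda>v. v) \<in> O[at_right 0](\<lambda>v. 1 :: real)"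
    by (rule bigoI_tendsto[of _ _ 0]) (auto intro: tendsto_eq_intros)
  have v2: "(\<lambda>v. v\<^sup>2) \<in> O[at_right 0](\<lambda>v. v :: real)"
    using landau_o.big.mult[OF landau_o.big_refl v1, of "\<lambda>v. v"] by (simp add: power2_eq_square)
  have av: "(\<lambda>v. a * v) \<in> O[at_right 0](\<lambda>v. v)" for a :: real by simp
  have f1: "f \<in> O[at_right 0](\<lambda>v. v)"
    using sum_in_bigo(1)[OF landau_o.big.trans[OF f v2] av[of a]] by simp
  have f0: "(\<lambda>v. 1 + f v) \<in> O[at_right 0](\<lambda>v. 1)"
    by (intro sum_in_bigo landau_o.big.trans[OF f1 v1]) auto
  show ?thesis
  proof (induction k)
    case 0
    then show ?case by simp
  next
    case (Suc k)
    have "(\<lambda>v. ((1 + f v) ^ k - 1 - real k * a * v) * (1 + f v)) \<in> O[at_right 0](\<lambda>v. v\<^sup>2)"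
      using landau_o.big.mult[OF Suc f0] by simp
    moreover have "(\<lambda>v. (real k * a * v) * f v) \<in> O[at_right 0](\<lambda>v. v\<^sup>2)"
      using landau_o.big.mult[OF av f1] by (simp add: power2_eq_square)
    ultimately have "(\<lambda>v. ((1 + f v) ^ k - 1 - real k * a * v) * (1 + f v)
        + (real k * a * v) * f v + (f v - a * v)) \<in> O[at_right 0](\<lambda>v. v\<^sup>2)"
      by (rule sum_in_bigo(1)[OF sum_in_bigo(1) f])
    then show ?case by (simp add: algebra_simps)
  qed
qed

lemma gamma2_expansion: "(\<lambda>v. gamma2 v - 2 * v) \<in> O[at_right 0](\<lambda>v. v\<^sup>2)"
  unfolding gamma2_def by (rule geometric_expansion)

text \<open>With \<open>m = 2 n - 1\<close>, clearing the inner denominators turns \<open>tau n v\<close> into \<open>2 m v / (1 - (2 + 2 m) v)\<close>.\<close>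

lemma tau_expansion:
  "(\<lambda>v. tau n v - 2 * (2 * real n - 1) * v) \<in> O[at_right 0](\<lambda>v. v\<^sup>2)"
proof -
  let ?m = "2 * real n - 1"
  have quotient: "tau n v = 2 * ?m * v / (1 - (2 + 2 * ?m) * v)" if "v < 1 / 2" for v
  proof -
    have "1 - 2 * v \<noteq> 0" using that by simp
    then have "1 - ?m * gamma2 v = (1 - (2 + 2 * ?m) * v) / (1 - 2 * v)"
      by (simp add: gamma2_def diff_divide_eq_iff algebra_simps)
    then have "tau n v = (?m * (2 * v / (1 - 2 * v))) / ((1 - (2 + 2 * ?m) * v) / (1 - 2 * v))"
      unfolding tau_def by (simp only: gamma2_def)
    also have "\<dots> = (?m * (2 * v)) / (1 - (2 + 2 * ?m) * v)"
      using \<open>1 - 2 * v \<noteq> 0\<close> by simp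
    finally show ?thesis by (simp only: mult.assoc mult.left_commute)
  qed
  have "\<forall>\<^sub>F v in at_right (0::real). v < 1 / 2"
    by (rule eventually_at_rightI[of _ "1 / 2"]) auto
  then have "\<forall>\<^sub>F v in at_right 0.
      tau n v - 2 * ?m * v = 2 * ?m * v / (1 - (2 + 2 * ?m) * v) - 2 * ?m * v"
    by (rule eventually_mono) (simp only: quotient)
  then show ?thesis
    by (rule landau_o.big.in_cong[THEN iffD2, OF _ geometric_expansion])
qed

section \<open>Error bounds\<close>

theorem mainTheorem3:
  fixes n k :: nat and Bs :: "real mat list" and A :: "real mat"
    and b x xhat :: "real vec"
    and u :: real and F :: "real set" and fl :: "flop \<Rightarrow> real \<Rightarrow> real \<Rightarrow> real"
  assumes "1 \<le> n" and "1 \<le> k" and "length Bs = k"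
    and "\<And>B. B \<in> set Bs \<Longrightarrow> B \<in> carrier_mat n n"
    and "\<And>B. B \<in> set Bs \<Longrightarrow> invertible_mat B"
    and "\<And>B. B \<in> set Bs \<Longrightarrow> upper_bidiagonal B \<or> lower_bidiagonal B"
    and "A = mat_prod n Bs"
    and "b \<in> carrier_vec n"
    and "x \<in> carrier_vec n" and "A *\<^sub>v x = b"
    and "standard_model u F fl"
    and "\<And>B. B \<in> set Bs \<Longrightarrow> elements_mat B \<subseteq> F" and "set\<^sub>v b \<subseteq> F"
    and "2 * u < 1" and "(2 * real n - 1) * gamma2 u < 1"
    and "successive_solve fl Bs b xhat"
  shows
    "abs_vec (b - A *\<^sub>v xhat)
       \<le> ((1 + gamma2 u) ^ k - 1) \<cdot>\<^sub>v (mat_prod n (map abs_mat Bs) *\<^sub>v abs_vec xhat)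
     \<and> abs_vec (xhat - x)
       \<le> ((1 + tau n u) ^ k - 1)
           \<cdot>\<^sub>v (mat_prod n (map (\<lambda>B. abs_mat (inv_mat B)) (rev Bs)) *\<^sub>v abs_vec b)
     \<and> ((\<forall>B \<in> set Bs. nonneg_mat B) \<or> (\<forall>B \<in> set Bs. checkerboard B) \<longrightarrow>
          abs_vec (b - A *\<^sub>v xhat)
            \<le> ((1 + gamma2 u) ^ k - 1) \<cdot>\<^sub>v (abs_mat A *\<^sub>v abs_vec xhat)
          \<and> (\<lambda>v. ((1 + gamma2 v) ^ k - 1) - 2 * real k * v) \<in> O[at_right 0](\<lambda>v. v\<^sup>2)
          \<and> abs_vec (xhat - x)
            \<le> ((1 + tau n u) ^ k - 1) \<cdot>\<^sub>v (abs_mat (inv_mat A) *\<^sub>v abs_vec b)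
          \<and> (\<lambda>v. ((1 + tau n v) ^ k - 1) - 2 * real k * (2 * real n - 1) * v)
              \<in> O[at_right 0](\<lambda>v. v\<^sup>2))"
proof -
  have u: "0 \<le> u" using \<open>standard_model u F fl\<close> by (simp add: standard_model_def)
  have Bs: "B \<in> carrier_mat n n \<and> invertible_mat B \<and> elements_mat B \<subseteq> F" if "B \<in> set Bs" for B
    using assms that by blast
  let ?N = "mat_prod n (map inv_mat (rev Bs))"
  note chains = successive_solve_chains[OF Bs \<open>standard_model u F fl\<close> \<open>2 * u < 1\<close>
      \<open>(2 * real n - 1) * gamma2 u < 1\<close> \<open>b \<in> carrier_vec n\<close> \<open>set\<^sub>v b \<subseteq> F\<close>
      \<open>successive_solve fl Bs b xhat\<close>]
  have invs: "M \<in> carrier_mat n n" if "M \<in> set (map inv_mat (rev Bs))" for M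
    using that Bs inv_mat_of_invertible(1) by auto
  have A: "A \<in> carrier_mat n n" using Bs \<open>A = mat_prod n Bs\<close> mat_prod_carrier by blast
  have N: "?N \<in> carrier_mat n n" "A * ?N = 1\<^sub>m n" "?N * A = 1\<^sub>m n"
    using mat_prod_inverse[of Bs n] Bs \<open>A = mat_prod n Bs\<close> by auto
  \<comment> \<open>The forward bound speaks of \<open>x\<close>; the chain through the inverses ends in \<open>?N b\<close>.\<close>
  have "?N *\<^sub>v b = ?N * A *\<^sub>v x"
    using N(1) A \<open>x \<in> carrier_vec n\<close> \<open>A *\<^sub>v x = b\<close> by (simp add: assoc_mult_mat_vec[of _ n n _ n])
  then have x: "?N *\<^sub>v b = x" using N(3) \<open>x \<in> carrier_vec n\<close> by simp
  have inv_A: "inv_mat A = ?N" using inv_mat_eqI[OF A N] .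
  have "0 \<le> gamma2 u" using u \<open>2 * u < 1\<close> by (simp add: gamma2_def)
  then have backward: "abs_vec (b - A *\<^sub>v xhat)
      \<le> ((1 + gamma2 u) ^ k - 1) \<cdot>\<^sub>v (mat_prod n (map abs_mat Bs) *\<^sub>v abs_vec xhat)"
    using perturbed_chain_bound[of n "gamma2 u" Bs b xhat] chains Bs assms(3,7,8) by auto
  have "0 \<le> tau n u"
    using \<open>0 \<le> gamma2 u\<close> \<open>1 \<le> n\<close> \<open>(2 * real n - 1) * gamma2 u < 1\<close> by (simp add: tau_def)
  then have forward': "abs_vec (xhat - x)
      \<le> ((1 + tau n u) ^ k - 1) \<cdot>\<^sub>v (mat_prod n (map abs_mat (map inv_mat (rev Bs))) *\<^sub>v abs_vec b)"
    using perturbed_chain_bound[of n "tau n u" "map inv_mat (rev Bs)" xhat b] chains invs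
      assms(3,8) x by simp
  then have forward: "abs_vec (xhat - x)
      \<le> ((1 + tau n u) ^ k - 1)
          \<cdot>\<^sub>v (mat_prod n (map (\<lambda>B. abs_mat (inv_mat B)) (rev Bs)) *\<^sub>v abs_vec b)"
    by (simp add: comp_def)
  have signs: "abs_mat A = mat_prod n (map abs_mat Bs)
      \<and> abs_mat (inv_mat A) = mat_prod n (map abs_mat (map inv_mat (rev Bs)))"
    if "(\<forall>B \<in> set Bs. nonneg_mat B) \<or> (\<forall>B \<in> set Bs. checkerboard B)"
  proof -
    have "\<exists>f :: nat \<Rightarrow> real. (\<forall>i. \<bar>f i\<bar> = 1) \<and> (\<forall>B \<in> set Bs. sign_similar f B)"
      using that
    proof
      assume "\<forall>B \<in> set Bs. nonneg_mat B"
      then show ?thesis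
        using nonneg_mat_sign_similar by (intro exI[of _ "\<lambda>i. 1"]) simp
    next
      assume "\<forall>B \<in> set Bs. checkerboard B"
      then show ?thesis
        using checkerboard_sign_similar[of _ n] Bs
        by (intro exI[of _ "\<lambda>i. (-1) ^ i"]) (auto simp: power_abs)
    qed
    then obtain f :: "nat \<Rightarrow> real"
      where f: "\<And>i. \<bar>f i\<bar> = 1" and sim: "\<And>B. B \<in> set Bs \<Longrightarrow> sign_similar f B"
      by blast
    have "sign_similar (\<lambda>i. f i * (-1) ^ i) (inv_mat B)" if "B \<in> set Bs" for B
      using inv_mat_sign_similar[of B n f] Bs[OF that] assms(6)[OF that] sim[OF that] f by blast
    then have "abs_mat ?N = mat_prod n (map abs_mat (map inv_mat (rev Bs)))"
      using invs f
      by (intro abs_mat_prod_sign_similar[where f = "\<lambda>i. f i * (-1) ^ i"]) (auto simp: abs_mult power_abs)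
    moreover have "abs_mat A = mat_prod n (map abs_mat Bs)"
      unfolding \<open>A = mat_prod n Bs\<close> using Bs sim f by (intro abs_mat_prod_sign_similar) auto
    ultimately show ?thesis by (simp add: inv_A)
  qed
  have "(\<lambda>v. ((1 + gamma2 v) ^ k - 1) - 2 * real k * v) \<in> O[at_right 0](\<lambda>v. v\<^sup>2)"
    using power_expansion[OF gamma2_expansion, of k] by (simp add: mult_ac)
  moreover have "(\<lambda>v. ((1 + tau n v) ^ k - 1) - 2 * real k * (2 * real n - 1) * v)
      \<in> O[at_right 0](\<lambda>v. v\<^sup>2)"
    using power_expansion[OF tau_expansion, of n k] by (simp add: mult.assoc mult.left_commute)
  ultimately show ?thesis
    using backward forward forward' signs by simp
qed

end
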